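(* Let $K$ be a field, $d\ge 2$, and let $\mathcal{H}$ be a $d$-uniform simple hypergraph on the vertex set $\{x_1,\dots,x_n\}$ which is triangulated and such that for every two distinct edges $S,S'$ of $\mathcal{H}$ with $S\cap S'\neq\emptyset$ we have $|S\cap S'|=d-1$. Let $R=K[x_1,\dots,x_n]$. Then: (1) for all integers $i,j$, $\beta_{i,j}(R/I(\mathcal{H}))\neq 0$ if and only if $\mathcal{H}$ contains a self disjoint set of type $(i,j)$; (2) $\mathrm{pd}(R/I(\mathcal{H}))=d_{1,\mathcal{H}}=d_{2,\mathcal{H}}$; (3) $\mathrm{reg}(R/I(\mathcal{H}))=d'_{1,\mathcal{H}}=d'_{2,\mathcal{H}}$.
   Context: A simple hypergraph $\mathcal{H}$ on $V(\mathcal{H})=\{x_1,\dots,x_n\}$ is a set $\mathcal{E}(\mathcal{H})$ of subsets of $V(\mathcal{H})$ (edges), each of cardinality at least $2$, with no edge contained in another; it is $d$-uniform if all edges have cardinality $d$. $R=K[x_1,\dots,x_n]$ is standard graded, $x^S=\prod_{x_i\in S}x_i$, and the edge ideal is $I(\mathcal{H})=\langle x^S : S\in\mathcal{E}(\mathcal{H})\rangle$. $\beta_{i,j}(R/I)=\dim_K\mathrm{Tor}_i^R(R/I,K)_j$, $\mathrm{pd}(R/I)=\max\{i:\beta_{i,j}\neq 0\text{ for some }j\}$, $\mathrm{reg}(R/I)=\max\{j-i:\beta_{i,j}\neq0\}$. For $W\subseteq V(\mathcal{H})$, the induced subhypergraph $\mathcal{H}_W$ has vertex set $W$ and edges the edges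 of $\mathcal{H}$ contained in $W$. For a vertex $x$, $N(x)=\{y: \{x,y\}\subseteq S\text{ for some } S\in\mathcal{E}(\mathcal{H})\}$ and $N[x]=\{x\}\cup N(x)$; $x$ is simplicial if every $d$-subset of $N[x]$ is an edge; $\mathcal{H}$ is triangulated if every induced subhypergraph of $\mathcal{H}$ has a simplicial vertex. For a family $\mathcal{S}=\{S_1,\dots,S_i\}$ of distinct edges, its type is $(i,j)$ where $j=|\bigcup_{\ell=1}^iS_\ell|$. $\mathcal{S}$ is a semi-induced matching if no edge of $\mathcal{H}$ outside $\mathcal{S}$ is contained in $\bigcup_{\ell}S_\ell$; an induced matching if it is a semi-induced matching whose edges are pairwise disjoint. $\mathcal{S}$ is a self disjoint set (resp. self semi-disjoint set) if (i) for all $k$, $S_k\nsubseteq\bigcup_{\ell\neq k}S_\ell$, and (ii) there is an induced matching (resp. a semi-induced matching) $\mathcal{S}_0\subseteq\mathcal{S}$ such that for every $S_\ell\in\mathcal{S}\setminus\mathcal{S}_0$ there is $S'\in\mathcal{S}_0$ with $|S_\ell\setminus S'|=1$. Define $d_{1,\mathcal{H}}$ (resp. $d_{2,\mathcal{H}}$) as the maximum $i$ such that there is a self disjoint (resp. self semi-disjoint) set of type $(i,j)$ for some $j$, and $d'_{1,\mathcal{H}}$ (resp. $d'_{2,\mathcal{H}}$) as the maximum of $j-i$ over self disjoint (resp. self semi-disjoint) sets of type $(i,j)$. (The empty family is regarded as a self disjoint set of type $(0,0)$.) *)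

theory Defs
  imports "Jordan_Normal_Form.DL_Rank"
begin

section \<open>Hypergraphs on the vertex set {0..<n} (vertex k stands for x_(k+1))\<close>

definition simple_hypergraph :: "nat \<Rightarrow> nat set set \<Rightarrow> bool" where
  "simple_hypergraph n E \<longleftrightarrow>
     (\<forall>S\<in>E. S \<subseteq> {..<n} \<and> 2 \<le> card S) \<and>
     (\<forall>S\<in>E. \<forall>T\<in>E. S \<subseteq> T \<longrightarrow> S = T)"

definition uniform :: "nat \<Rightarrow> nat set set \<Rightarrow> bool" where
  "uniform d E \<longleftrightarrow> (\<forall>S\<in>E. card S = d)"

definition induced_edges :: "nat set set \<Rightarrow> nat set \<Rightarrow> nat set set" where
  "induced_edges E W = {S\<in>E. S \<subseteq> W}"

definition nbhd :: "nat set set \<Rightarrow> nat \<Rightarrow> nat set" where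
  "nbhd E x = {y. \<exists>S\<in>E. x \<in> S \<and> y \<in> S \<and> y \<noteq> x}"

definition closed_nbhd :: "nat set set \<Rightarrow> nat \<Rightarrow> nat set" where
  "closed_nbhd E x = insert x (nbhd E x)"

definition simplicial :: "nat \<Rightarrow> nat set set \<Rightarrow> nat \<Rightarrow> bool" where
  "simplicial d E x \<longleftrightarrow> (\<forall>T. T \<subseteq> closed_nbhd E x \<and> card T = d \<longrightarrow> T \<in> E)"

definition triangulated :: "nat \<Rightarrow> nat \<Rightarrow> nat set set \<Rightarrow> bool" where
  "triangulated d n E \<longleftrightarrow>
     (\<forall>W. W \<subseteq> {..<n} \<and> W \<noteq> {} \<longrightarrow> (\<exists>x\<in>W. simplicial d (induced_edges E W) x))"

definition semi_induced_matching :: "nat set set \<Rightarrow> nat set set \<Rightarrow> bool" where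
  "semi_induced_matching E \<S> \<longleftrightarrow> \<S> \<subseteq> E \<and> (\<forall>S\<in>E - \<S>. \<not> S \<subseteq> \<Union>\<S>)"

definition induced_matching :: "nat set set \<Rightarrow> nat set set \<Rightarrow> bool" where
  "induced_matching E \<S> \<longleftrightarrow> semi_induced_matching E \<S> \<and>
     (\<forall>S\<in>\<S>. \<forall>T\<in>\<S>. S \<noteq> T \<longrightarrow> S \<inter> T = {})"

definition self_disj_aux :: "(nat set set \<Rightarrow> nat set set \<Rightarrow> bool) \<Rightarrow> nat set set \<Rightarrow> nat set set \<Rightarrow> bool" where
  "self_disj_aux P E \<S> \<longleftrightarrow> \<S> \<subseteq> E \<and>
     (\<forall>S\<in>\<S>. \<not> S \<subseteq> \<Union>(\<S> - {S})) \<and>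
     (\<exists>\<S>0 \<subseteq> \<S>. P E \<S>0 \<and> (\<forall>S\<in>\<S> - \<S>0. \<exists>S'\<in>\<S>0. card (S - S') = 1))"

definition self_disjoint :: "nat set set \<Rightarrow> nat set set \<Rightarrow> bool" where
  "self_disjoint E \<S> \<longleftrightarrow> self_disj_aux induced_matching E \<S>"

definition self_semi_disjoint :: "nat set set \<Rightarrow> nat set set \<Rightarrow> bool" where
  "self_semi_disjoint E \<S> \<longleftrightarrow> self_disj_aux semi_induced_matching E \<S>"

definition has_type :: "nat set set \<Rightarrow> nat \<Rightarrow> nat \<Rightarrow> bool" where
  "has_type \<S> i j \<longleftrightarrow> card \<S> = i \<and> card (\<Union>\<S>) = j"

definition d1 :: "nat set set \<Rightarrow> nat" where
  "d1 E = Max {i. \<exists>\<S> j. self_disjoint E \<S> \<and> has_type \<S> i j}"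
definition d2 :: "nat set set \<Rightarrow> nat" where
  "d2 E = Max {i. \<exists>\<S> j. self_semi_disjoint E \<S> \<and> has_type \<S> i j}"
definition d1' :: "nat set set \<Rightarrow> int" where
  "d1' E = Max {int j - int i | i j. \<exists>\<S>. self_disjoint E \<S> \<and> has_type \<S> i j}"
definition d2' :: "nat set set \<Rightarrow> int" where
  "d2' E = Max {int j - int i | i j. \<exists>\<S>. self_semi_disjoint E \<S> \<and> has_type \<S> i j}"

text \<open>Tor_i^R(R/I,K)_j is computed as the degree-j part of the i-th homology of the
Koszul complex K(x_1,...,x_n; R/I).  R/I has the K-basis of monomials x^m not in I,
i.e. not divisible by any x^S, S an edge; a monomial is an exponent vector m with
support in {0..<n}.  The degree-j part of the i-th Koszul module has K-basis
e_F (x) x^m with card F = i and deg m = j - i.\<close>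

definition mons :: "nat \<Rightarrow> nat \<Rightarrow> (nat \<Rightarrow> nat) set" where
  "mons n t = {m. (\<forall>k. n \<le> k \<longrightarrow> m k = 0) \<and> (\<Sum>k<n. m k) = t}"

definition std_mon :: "nat set set \<Rightarrow> (nat \<Rightarrow> nat) \<Rightarrow> bool" where
  "std_mon E m \<longleftrightarrow> (\<forall>S\<in>E. \<not> (\<forall>k\<in>S. 0 < m k))"

definition kbasis :: "nat set set \<Rightarrow> nat \<Rightarrow> nat \<Rightarrow> nat \<Rightarrow> (nat set \<times> (nat \<Rightarrow> nat)) set" where
  "kbasis E n i j = {(F, m). F \<subseteq> {..<n} \<and> card F = i \<and> i \<le> j \<and> m \<in> mons n (j - i) \<and> std_mon E m}"

definition enum_set :: "'a set \<Rightarrow> 'a list" where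
  "enum_set B = (SOME xs. distinct xs \<and> set xs = B)"

text \<open>Coefficient of e_G (x) x^m' in d(e_F (x) x^m), where
d(e_F (x) x^m) = sum over k in F of (-1)^(#{l in F. l < k}) e_(F-{k}) (x) x_k x^m.\<close>
definition koszul_coeff :: "nat set \<times> (nat \<Rightarrow> nat) \<Rightarrow> nat set \<times> (nat \<Rightarrow> nat) \<Rightarrow> 'k::field" where
  "koszul_coeff tgt src =
     (case tgt of (G, m') \<Rightarrow> case src of (F, m) \<Rightarrow>
       if G \<subseteq> F \<and> card (F - G) = 1 \<and> m' = m(the_elem (F - G) := Suc (m (the_elem (F - G))))
       then (- 1) ^ card {l\<in>F. l < the_elem (F - G)} else 0)"

definition koszul_mat :: "nat set set \<Rightarrow> nat \<Rightarrow> nat \<Rightarrow> nat \<Rightarrow> 'k::field mat" where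
  "koszul_mat E n i j =
     (let rs = enum_set (kbasis E n (i - 1) j); cs = enum_set (kbasis E n i j)
      in mat (length rs) (length cs) (\<lambda>(r, c). koszul_coeff (rs ! r) (cs ! c)))"

definition koszul_rank :: "'k::field itself \<Rightarrow> nat set set \<Rightarrow> nat \<Rightarrow> nat \<Rightarrow> nat \<Rightarrow> nat" where
  "koszul_rank ty E n i j =
     (if i = 0 then 0
      else vec_space.rank (dim_row (koszul_mat E n i j :: 'k mat)) (koszul_mat E n i j :: 'k mat))"

text \<open>beta_(i,j)(R/I(H)) over the field 'k: dim ker d_i - dim im d_(i+1) in degree j.\<close>
definition betti :: "'k::field itself \<Rightarrow> nat \<Rightarrow> nat set set \<Rightarrow> nat \<Rightarrow> nat \<Rightarrow> nat" where
  "betti ty n E i j =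
     card (kbasis E n i j) - koszul_rank ty E n i j - koszul_rank ty E n (Suc i) j"

definition proj_dim :: "'k::field itself \<Rightarrow> nat \<Rightarrow> nat set set \<Rightarrow> nat" where
  "proj_dim ty n E = Max {i. \<exists>j. betti ty n E i j \<noteq> 0}"

definition regularity :: "'k::field itself \<Rightarrow> nat \<Rightarrow> nat set set \<Rightarrow> int" where
  "regularity ty n E = Max {int j - int i | i j. betti ty n E i j \<noteq> 0}"

end

theory Submission
  imports Defs
begin

text \<open>By Hochster's formula, \<open>\<beta>\<^sub>i\<^sub>,\<^sub>j\<close> is nonzero iff for some \<open>j\<close>-set \<open>W\<close> of vertices the independence complex
  of the induced hypergraph on \<open>W\<close> has cohomology on its \<open>(j - i)\<close>-element faces. Let \<open>x\<close> be a simplicial vertex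
  of \<open>W\<close> and \<open>y\<close> a neighbour of \<open>x\<close>. Exchanging \<open>y\<close> for \<open>x\<close> keeps sets independent, so the inclusion of
  the link of \<open>y\<close> into its deletion is null-homotopic and the cohomology of the complex is the sum of
  the cohomology of the deletion and the shifted one of the link. Removing all neighbours of
  \<open>x\<close> in this way leaves one summand for each \<open>(d - 1)\<close>-set \<open>C\<close> of neighbours, the shifted cohomology
  for \<open>W\<close> without \<open>C\<close> and all \<open>z\<close> such that \<open>C \<union> {z}\<close> is an edge (the petals of \<open>C\<close>); here the condition on
  intersections of edges enters. Self disjoint sets covering \<open>W\<close> obey the same recursion: the
  edges \<open>C \<union> {z}\<close> form a star that is added or removed. Finally, a maximal disjoint
  subfamily of a semi-induced matching shows that self semi-disjoint sets are self disjoint.\<close>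

section \<open>Matrix rank and exactness\<close>

lemma mat_linear_map:
  fixes A :: "'k::field mat"
  assumes A: "A \<in> carrier_mat p q"
  shows "linear_map class_ring (module_vec TYPE('k) q) (module_vec TYPE('k) p) (\<lambda>v. A *\<^sub>v v)"
proof -
  have "(\<lambda>v. A *\<^sub>v v) \<in> LinearCombinations.module_hom class_ring (module_vec TYPE('k) q) (module_vec TYPE('k) p)"
    using A
      by (auto simp: LinearCombinations.module_hom_def module_vec_simps mult_add_distrib_mat_vec mult_mat_vec)
  then show ?thesis
    by (intro linear_map.intro mod_hom.intro vec_vs vec_module mod_hom_axioms.intro)
qed
lemma rank_nullity_mat:
  fixes A :: "'k::field mat"
  assumes A: "A \<in> carrier_mat p q"
  shows "vec_space.rank p A
    + vectorspace.dim class_ring ((module_vec TYPE('k) q)\<lparr>carrier := {v \<in> carrier_vec q. A *\<^sub>v v = 0\<^sub>v p}\<rparr>) = q"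
proof -
  interpret Q: vec_space "TYPE('k)" q .
  interpret P: vec_space "TYPE('k)" p .
  note L = mat_linear_map[OF A]
  have M: "mod_hom class_ring (module_vec TYPE('k) q) (module_vec TYPE('k) p) (\<lambda>v. A *\<^sub>v v)"
    using L by (simp add: linear_map_def)
  have im: "mod_hom.im (module_vec TYPE('k) q) (\<lambda>v. A *\<^sub>v v) = P.span (set (cols A))"
    using P.col_space_eq[OF A] A unfolding P.col_space_def mod_hom.im_def[OF M]
    by (auto simp: module_vec_simps image_def)
  have ker: "mod_hom.ker (module_vec TYPE('k) q) (module_vec TYPE('k) p) (\<lambda>v. A *\<^sub>v v)
      = {v \<in> carrier_vec q. A *\<^sub>v v = 0\<^sub>v p}"
    using A unfolding mod_hom.ker_def[OF M] by (auto simp: module_vec_simps)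
  from linear_map.rank_nullity[OF L Q.fin_dim] show ?thesis
    unfolding im ker P.rank_def Q.dim_is_n .
qed

text \<open>Independent sets in the subspace stay independent in the whole space, so
  \<open>dim\<close> bounds their size and a maximal one exists; it is a basis.\<close>

lemma (in vectorspace) subspace_fin_dim:
  assumes X: "subspace K X V" and fd: "fin_dim"
  shows "vectorspace.fin_dim K (vs X)"
proof -
  have sub: "submodule K X V" using X by (simp add: subspace_def)
  have XV: "X \<subseteq> carrier V" using sub by (simp add: submodule_def)
  interpret X: vectorspace K "vs X" by (rule subspace_is_vs[OF X])
  let ?P = "\<lambda>S. S \<subseteq> carrier (vs X) \<and> X.lin_indpt S"
  have "\<exists>A. finite A \<and> maximal A ?P"
  proof (rule maximal_exists[where N = dim and B = "{}"])
    fix A assume A: "?P A"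
    then have AX: "A \<subseteq> X" by simp
    have "lin_indpt A" using A span_li_not_depend(2)[OF AX sub] by simp
    then show "finite A \<and> card A \<le> dim"
      using li_le_dim[OF fd] AX XV by blast
  qed (simp add: X.lin_dep_def)
  then obtain A where "finite A" "maximal A ?P" by blast
  then have "X.basis A" by (intro X.max_li_is_basis) 
  with \<open>finite A\<close> show ?thesis unfolding X.fin_dim_def X.basis_def by blast
qed

lemma (in vectorspace) subspace_dim_eq:
  assumes X: "subspace K X V" and fd: "fin_dim" and le: "dim \<le> vectorspace.dim K (vs X)"
  shows "X = carrier V"
proof -
  have sub: "submodule K X V" using X by (simp add: subspace_def)
  have XV: "X \<subseteq> carrier V" using sub by (simp add: submodule_def)
  interpret X: vectorspace K "vs X" by (rule subspace_is_vs[OF X])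
  obtain b where b: "finite b" "X.basis b"
    using X.finite_basis_exists subspace_fin_dim[OF X fd] by blast
  have bX: "b \<subseteq> X" and li: "X.lin_indpt b" and sp: "X.span b = X"
    using b by (auto simp: X.basis_def)
  have "card b = X.dim" using X.dim_basis[OF b] by simp
  moreover have "lin_indpt b" using li span_li_not_depend(2)[OF bX sub] by simp
  ultimately have "basis b" using dim_li_is_basis[OF fd b(1)] bX XV le by auto
  then have "span b = carrier V" by (simp add: basis_def)
  then show ?thesis using sp span_li_not_depend(1)[OF bX sub] by simp
qed

text \<open>\<open>AB\<close> puts the image of \<open>B\<close> inside the kernel of
  \<open>A\<close>, whose dimension is \<open>q\<close> minus the rank of \<open>A\<close>; the
  inequality says that the two coincide. It turns the vanishing of a Betti number, defined through
  ranks, into exactness.\<close>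

lemma rank_add_rank_ge_iff:
  fixes A B :: "'k::field mat"
  assumes A: "A \<in> carrier_mat p q" and B: "B \<in> carrier_mat q r"
    and AB: "\<And>w. w \<in> carrier_vec r \<Longrightarrow> A *\<^sub>v (B *\<^sub>v w) = 0\<^sub>v p"
  shows "q \<le> vec_space.rank p A + vec_space.rank q B \<longleftrightarrow>
    (\<forall>v \<in> carrier_vec q. A *\<^sub>v v = 0\<^sub>v p \<longrightarrow> (\<exists>w \<in> carrier_vec r. B *\<^sub>v w = v))"
proof -
  interpret Q: vec_space "TYPE('k)" q .
  let ?V = "module_vec TYPE('k) q"
  let ?ker = "{v \<in> carrier_vec q. A *\<^sub>v v = 0\<^sub>v p}"
  let ?im = "{v \<in> carrier_vec q. \<exists>w \<in> carrier_vec r. B *\<^sub>v w = v}"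
  have im: "?im = Q.span (set (cols B))"
    using Q.col_space_eq[OF B] B unfolding Q.col_space_def by auto
  have M: "mod_hom class_ring ?V (module_vec TYPE('k) p) (\<lambda>v. A *\<^sub>v v)"
    using mat_linear_map[OF A] by (simp add: linear_map_def)
  have ker: "mod_hom.ker ?V (module_vec TYPE('k) p) (\<lambda>v. A *\<^sub>v v) = ?ker"
    using A unfolding mod_hom.ker_def[OF M] by (auto simp: module_vec_simps)
  have subker: "subspace class_ring ?ker ?V"
    using linear_map.kerT_is_subspace[OF mat_linear_map[OF A]] unfolding ker .
  have subim: "subspace class_ring ?im ?V"
    unfolding im by (rule Q.span_is_subspace) (use B cols_dim[of B] in simp)
  have le: "?im \<subseteq> ?ker" using AB by auto
  interpret Ker: vectorspace class_ring "?V\<lparr>carrier := ?ker\<rparr>"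
    by (rule Q.subspace_is_vs[OF subker])
  have sub: "subspace class_ring ?im (?V\<lparr>carrier := ?ker\<rparr>)"
    by (rule Q.nested_subspaces[OF subker subim le])
  have fd: "Ker.fin_dim" by (rule Q.subspace_fin_dim[OF subker Q.fin_dim])
  have rB: "vec_space.rank q B = vectorspace.dim class_ring (?V\<lparr>carrier := ?im\<rparr>)"
    unfolding im Q.rank_def ..
  have "q \<le> vec_space.rank p A + vec_space.rank q B
      \<longleftrightarrow> Ker.dim \<le> vectorspace.dim class_ring (?V\<lparr>carrier := ?im\<rparr>)"
    using rank_nullity_mat[OF A] unfolding rB by linarith
  also have "\<dots> \<longleftrightarrow> ?im = ?ker"
  proof
    assume "Ker.dim \<le> vectorspace.dim class_ring (?V\<lparr>carrier := ?im\<rparr>)"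
    with Ker.subspace_dim_eq[OF sub fd] show "?im = ?ker" by simp
  next
    assume "?im = ?ker"
    then show "Ker.dim \<le> vectorspace.dim class_ring (?V\<lparr>carrier := ?im\<rparr>)" by simp
  qed
  also have "\<dots> \<longleftrightarrow> (\<forall>v \<in> carrier_vec q. A *\<^sub>v v = 0\<^sub>v p \<longrightarrow> (\<exists>w \<in> carrier_vec r. B *\<^sub>v w = v))"
    using le by blast
  finally show ?thesis .
qed

section \<open>Koszul differentials on families of sets\<close>

definition koszul_sign :: "nat \<Rightarrow> nat set \<Rightarrow> 'k::comm_ring_1" where
  "koszul_sign k G = (- 1) ^ card {l \<in> G. l < k}"

text \<open>The boundary of the chain with coefficients \<open>c\<close>, read off at the basis
  element \<open>e_G\<close>: only the sets \<open>insert k G\<close> map onto it. Exponents are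
  suppressed, since a fixed multidegree determines them from \<open>G\<close>.\<close>

definition koszul_diff :: "nat set \<Rightarrow> (nat set \<Rightarrow> 'k::comm_ring_1) \<Rightarrow> nat set \<Rightarrow> 'k" where
  "koszul_diff V c G = (\<Sum>k\<in>V - G. koszul_sign k G * c (insert k G))"

lemma koszul_sign_sq [simp]: "koszul_sign k G * koszul_sign k G = 1"
  by (simp add: koszul_sign_def power_mult_distrib[symmetric])

lemma koszul_sign_sq_left [simp]: "koszul_sign k G * (koszul_sign k G * a) = a"
  by (simp add: mult.assoc[symmetric])

lemma koszul_sign_nonzero [simp]: "koszul_sign k G \<noteq> (0 :: 'k::field)"
  by (simp add: koszul_sign_def)

lemma koszul_sign_insert:
  assumes "finite G" "y \<notin> G"
  shows "koszul_sign k (insert y G) = (if y < k then - koszul_sign k G else koszul_sign k G)"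
proof (cases "y < k")
  case True
  then have "{l \<in> insert y G. l < k} = insert y {l \<in> G. l < k}" by auto
  with True assms show ?thesis by (simp add: koszul_sign_def)
next
  case False
  then have "{l \<in> insert y G. l < k} = {l \<in> G. l < k}" by auto
  with False show ?thesis by (simp add: koszul_sign_def)
qed

text \<open>The relation \<open>e_k e_y = - e_y e_k\<close>: exactly one of \<open>y < k\<close> and
  \<open>k < y\<close> holds. The two factors for \<open>y\<close> are those that renormalize chains
  in \<open>koszul_diff_insert_in\<close>.\<close>

lemma koszul_sign_swap:
  assumes "finite H" "k \<notin> H" "y \<notin> H" "k \<noteq> y"
  shows "koszul_sign k (insert y H) = - (koszul_sign y H * (koszul_sign k H * koszul_sign y (insert k H)) :: 'k::comm_ring_1)"
proof -
  have "koszul_sign y H * (koszul_sign k H * koszul_sign y H) = (koszul_sign k H :: 'k)"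
    by (simp add: mult.left_commute)
  with assms show ?thesis by (auto simp: koszul_sign_insert)
qed

lemma koszul_diff_cong:
  assumes "\<And>k. k \<in> V - G \<Longrightarrow> c (insert k G) = c' (insert k G)"
  shows "koszul_diff V c G = koszul_diff V c' G"
  unfolding koszul_diff_def using assms by (intro sum.cong) auto

lemma koszul_diff_add: "koszul_diff V (\<lambda>F. a F + b F) G = koszul_diff V a G + koszul_diff V b G"
  by (simp add: koszul_diff_def algebra_simps sum.distrib)

lemma koszul_diff_uminus: "koszul_diff V (\<lambda>F. - a F) G = - koszul_diff V a G"
  by (simp add: koszul_diff_def sum_negf)

lemma koszul_diff_zero [simp]: "koszul_diff V (\<lambda>F. 0) G = 0"
  by (simp add: koszul_diff_def)

lemma koszul_diff_insert_notin:
  assumes "finite V" "y \<notin> V" "H \<subseteq> V"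
  shows "koszul_diff (insert y V) c H = koszul_diff V c H + koszul_sign y H * c (insert y H)"
proof -
  have "insert y V - H = insert y (V - H)" using assms by auto
  with assms show ?thesis by (simp add: koszul_diff_def add.commute)
qed

text \<open>Write a chain as c0 + e_y c1, where c1 sends \<open>G\<close> to
  \<open>koszul_sign y G * c (insert y G)\<close>. Together with
  \<open>koszul_diff_insert_notin\<close>, the differential becomes (c0, c1) -> (d c0 + c1, - d c1),
  the form of a mapping cone.\<close>

lemma koszul_diff_insert_in:
  assumes "finite V" "y \<notin> V" "H \<subseteq> V"
  shows "koszul_diff (insert y V) c (insert y H)
    = - (koszul_sign y H * koszul_diff V (\<lambda>G. koszul_sign y G * c (insert y G)) H)"
proof -
  have fin: "finite H" using assms finite_subset by blast
  have "koszul_diff (insert y V) c (insert y H)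
      = (\<Sum>k\<in>V - H. koszul_sign k (insert y H) * c (insert k (insert y H)))"
    using assms unfolding koszul_diff_def by (intro sum.cong) auto
  also have "\<dots> = (\<Sum>k\<in>V - H. - (koszul_sign y H *
      (koszul_sign k H * (koszul_sign y (insert k H) * c (insert y (insert k H))))))"
  proof (intro sum.cong refl)
    fix k assume k: "k \<in> V - H"
    with assms have "koszul_sign k (insert y H)
        = - (koszul_sign y H * (koszul_sign k H * koszul_sign y (insert k H)) :: 'a)"
      by (intro koszul_sign_swap fin) auto
    then show "koszul_sign k (insert y H) * c (insert k (insert y H)) = - (koszul_sign y H *
      (koszul_sign k H * (koszul_sign y (insert k H) * c (insert y (insert k H)))))"
      by (simp add: insert_commute mult.assoc)
  qed
  finally show ?thesis by (simp add: koszul_diff_def sum_negf sum_distrib_left)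
qed

text \<open>Applying (c0, c1) -> (d c0 + c1, - d c1) twice gives d d c0 + d c1 - d c1 and d d c1, so
  induction on the vertex set suffices.\<close>

lemma koszul_diff_diff:
  assumes "finite V" "G \<subseteq> V"
  shows "koszul_diff V (koszul_diff V c) G = 0"
  using assms
proof (induction V arbitrary: c G)
  case empty
  then show ?case by (simp add: koszul_diff_def)
next
  case (insert y V)
  let ?W = "insert y V"
  let ?c1 = "\<lambda>G. koszul_sign y G * c (insert y G)"
  note out = koszul_diff_insert_notin[OF insert.hyps(1,2)]
  note inn = koszul_diff_insert_in[OF insert.hyps(1,2)]
  show ?case
  proof (cases "y \<in> G")
    case False
    with insert.prems have G: "G \<subseteq> V" by auto
    have "koszul_diff V (koszul_diff ?W c) G = koszul_diff V (\<lambda>H. koszul_diff V c H + ?c1 H) G"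
      using G by (intro koszul_diff_cong out) auto
    then show ?thesis by (simp add: out inn G koszul_diff_add insert.IH)
  next
    case True
    define H where "H = G - {y}"
    with True insert.prems have H: "H \<subseteq> V" and G: "G = insert y H" by auto
    have "koszul_diff V (\<lambda>F. koszul_sign y F * koszul_diff ?W c (insert y F)) H
        = koszul_diff V (\<lambda>F. - koszul_diff V ?c1 F) H"
      using H by (intro koszul_diff_cong) (simp add: inn)
    then show ?thesis by (simp add: G inn H koszul_diff_uminus insert.IH)
  qed
qed

text \<open>Exterior multiplication by the basis vector of \<open>x\<close>, a contracting homotopy.\<close>
definition koszul_cone :: "nat \<Rightarrow> (nat set \<Rightarrow> 'k::comm_ring_1) \<Rightarrow> nat set \<Rightarrow> 'k" where
  "koszul_cone x c H = (if x \<in> H then koszul_sign x (H - {x}) * c (H - {x}) else 0)"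

text \<open>The homotopy identity d(e_x c) + e_x d c = c, read at the single set \<open>G\<close>.
  The term e_x d c has a coefficient there only if \<open>x\<close> lies in \<open>G\<close>, and it
  is d c at \<open>G - {x}\<close> up to sign; hence the form of \<open>cyc\<close>.\<close>

lemma koszul_diff_cone:
  assumes "finite V" "x \<in> V" "G \<subseteq> V"
    and cyc: "x \<in> G \<Longrightarrow> koszul_diff V c (G - {x}) = 0"
  shows "koszul_diff V (koszul_cone x c) G = c G"
proof -
  define U where "U = V - {x}"
  have U: "finite U" "x \<notin> U" and V: "V = insert x U" using assms by (auto simp: U_def)
  note out = koszul_diff_insert_notin[OF U]
  note inn = koszul_diff_insert_in[OF U]
  show ?thesis
  proof (cases "x \<in> G")
    case False
    with assms have G: "G \<subseteq> U" by (auto simp: U_def)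
    have "koszul_diff U (koszul_cone x c) G = koszul_diff U (\<lambda>_. 0) G"
      using U False by (intro koszul_diff_cong) (auto simp: koszul_cone_def)
    with False show ?thesis by (simp add: V out G koszul_cone_def)
  next
    case True
    define H where "H = G - {x}"
    with True assms have H: "H \<subseteq> U" "x \<notin> H" and G: "G = insert x H" by (auto simp: U_def)
    have "koszul_diff U (\<lambda>F. koszul_sign x F * koszul_cone x c (insert x F)) H = koszul_diff U c H"
    proof (intro koszul_diff_cong)
      fix k assume "k \<in> U - H"
      then have "insert x (insert k H) - {x} = insert k H" using H U by auto
      then show "koszul_sign x (insert k H) * koszul_cone x c (insert x (insert k H)) = c (insert k H)"
        by (simp add: koszul_cone_def)
    qed
    moreover have "koszul_diff U c H = - (koszul_sign x H * c G)"
      using cyc[OF True] out[OF H(1), of c] unfolding H_def[symmetric]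
      by (simp add: V G eq_neg_iff_add_eq_0)
    ultimately show ?thesis by (simp add: V G inn H)
  qed
qed

text \<open>The degree is an integer so that degree \<open>-1\<close> needs no special case. \<open>B\<close> is meant to be closed
  under adding elements of \<open>V\<close>; then \<open>koszul_diff V c G\<close> with \<open>G \<in> B\<close> only sees the values of \<open>c\<close> on
  \<open>B\<close>, and chains need not be required to vanish elsewhere.\<close>
definition koszul_exact :: "'k::field itself \<Rightarrow> nat set \<Rightarrow> nat set set \<Rightarrow> int \<Rightarrow> bool" where
  "koszul_exact K V B i \<longleftrightarrow> (\<forall>c :: nat set \<Rightarrow> 'k.
     (\<forall>G\<in>B. int (card G) = i - 1 \<longrightarrow> koszul_diff V c G = 0) \<longrightarrow>
     (\<exists>b. \<forall>F\<in>B. int (card F) = i \<longrightarrow> koszul_diff V b F = c F))"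

text \<open>Multiplication by e_x solves the boundary equation on \<open>B0\<close> while the cycle
  condition is known on \<open>B1\<close>. For \<open>B0 = B1\<close> this is a cone; for different
  families it is a null-homotopy of a restriction map.\<close>

lemma koszul_exact_null:
  fixes c :: "nat set \<Rightarrow> 'k::field"
  assumes V: "finite V" "x \<in> V" and B: "B0 \<subseteq> Pow V" "\<And>H. H \<in> B0 \<Longrightarrow> x \<in> H \<Longrightarrow> H - {x} \<in> B1"
    and cyc: "\<And>G. G \<in> B1 \<Longrightarrow> int (card G) = i - 1 \<Longrightarrow> koszul_diff V c G = 0"
    and G: "G \<in> B0" "int (card G) = i"
  shows "koszul_diff V (koszul_cone x c) G = c G"
proof (rule koszul_diff_cone[OF V])
  show GV: "G \<subseteq> V" using B G by auto
  assume "x \<in> G"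
  moreover have "finite G" using GV V(1) by (rule finite_subset)
  ultimately have "card G = Suc (card (G - {x}))" by (intro card.remove)
  then have "int (card (G - {x})) = i - 1" using G by linarith
  with B G \<open>x \<in> G\<close> show "koszul_diff V c (G - {x}) = 0" by (intro cyc) auto
qed

lemma koszul_exact_cone:
  assumes "finite V" "x \<in> V" "B \<subseteq> Pow V" "\<And>H. H \<in> B \<Longrightarrow> x \<in> H \<Longrightarrow> H - {x} \<in> B"
  shows "koszul_exact K V B i"
  unfolding koszul_exact_def using koszul_exact_null[OF assms] by blast

text \<open>Sorting basis elements by whether they contain \<open>y\<close> presents the complex as the mapping cone of the
  restriction map from \<open>B1\<close> to \<open>B0\<close>. The last assumption makes this map null-homotopic, so that
  the homology is a direct sum.\<close>
lemma koszul_exact_split: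
  fixes K :: "'k::field itself"
  assumes V: "finite V" "y \<notin> V" and B: "B \<subseteq> Pow (insert y V)"
    and up: "\<And>F. F \<in> B \<Longrightarrow> insert y F \<in> B"
    and B0: "B0 = {H. H \<subseteq> V \<and> H \<in> B}" and B1: "B1 = {H. H \<subseteq> V \<and> insert y H \<in> B}"
    and null: "B0 = {} \<or> (\<exists>x\<in>V. \<forall>H\<in>B0. x \<in> H \<longrightarrow> H - {x} \<in> B1)"
  shows "koszul_exact K (insert y V) B i \<longleftrightarrow> koszul_exact K V B1 (i - 1) \<and> koszul_exact K V B0 i"
proof -
  note out = koszul_diff_insert_notin[OF V]
  note inn = koszul_diff_insert_in[OF V]
  have card_ins: "card (insert y H) = Suc (card H)" if "H \<subseteq> V" for H
    using that V finite_subset[of H V] by (auto intro!: card_insert_disjoint)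
  have B01: "H \<in> B1" if "H \<in> B0" for H using that up by (auto simp: B0 B1)
  have split: "H \<in> B0 \<or> (\<exists>H'\<in>B1. H = insert y H')" if "H \<in> B" for H
  proof (cases "y \<in> H")
    case True
    then have "H = insert y (H - {y})" "H - {y} \<subseteq> V" using that B by auto
    moreover from this that have "H - {y} \<in> B1" unfolding B1 by simp
    ultimately show ?thesis by blast
  qed (use that B in \<open>auto simp: B0\<close>)
  have sub: "H \<subseteq> V" if "H \<in> B0 \<or> H \<in> B1" for H using that by (auto simp: B0 B1)
  \<comment> \<open>The restriction map kills homology: a cycle on \<open>B1\<close> bounds on
    \<open>B0\<close>.\<close>
  have nul: "\<exists>h. \<forall>G\<in>B0. int (card G) = j \<longrightarrow> koszul_diff V h G = c G"
    if "\<And>G. G \<in> B1 \<Longrightarrow> int (card G) = j - 1 \<Longrightarrow> koszul_diff V c G = 0" for c :: "nat set \<Rightarrow> 'k" and j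
    using null
  proof
    assume "\<exists>x\<in>V. \<forall>H\<in>B0. x \<in> H \<longrightarrow> H - {x} \<in> B1"
    then obtain x where "x \<in> V" "\<forall>H\<in>B0. x \<in> H \<longrightarrow> H - {x} \<in> B1" by blast
    moreover have "B0 \<subseteq> Pow V" using sub by auto
    ultimately show ?thesis using koszul_exact_null[OF V(1), of x B0 B1 j c] that by blast
  qed auto
  show ?thesis
  proof (intro iffI conjI)
    assume ex: "koszul_exact K (insert y V) B i"
    show "koszul_exact K V B1 (i - 1)" unfolding koszul_exact_def
    proof (intro allI impI)
      fix c1 :: "nat set \<Rightarrow> 'k"
      assume cyc: "\<forall>G\<in>B1. int (card G) = i - 1 - 1 \<longrightarrow> koszul_diff V c1 G = 0"
      then obtain h where h: "\<forall>G\<in>B0. int (card G) = i - 1 \<longrightarrow> koszul_diff V h G = c1 G"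
        using nul[of "i - 1" c1] by blast
      \<comment> \<open>The cycle e_y c1 - h lifts c1: on \<open>B0\<close> the term - d h cancels
        c1.\<close>
      define c where "c F = (if y \<in> F then koszul_sign y (F - {y}) * c1 (F - {y}) else - h F)" for F
      have c_in: "koszul_sign y H * c (insert y H) = c1 H" if "H \<subseteq> V" for H
      proof -
        have "insert y H - {y} = H" using that V by auto
        then show ?thesis by (simp add: c_def)
      qed
      have c_out: "koszul_diff V c H = - koszul_diff V h H" if "H \<subseteq> V" for H
        unfolding koszul_diff_uminus[symmetric] using that V
        by (intro koszul_diff_cong) (auto simp: c_def)
      have c_diff: "koszul_diff V (\<lambda>G. koszul_sign y G * c (insert y G)) H = koszul_diff V c1 H"
        if "H \<subseteq> V" for H
        using that by (intro koszul_diff_cong c_in) auto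
      have "koszul_diff (insert y V) c G = 0" if "G \<in> B" "int (card G) = i - 1" for G
        using split[OF that(1)]
      proof
        assume G: "G \<in> B0"
        then show ?thesis using h that sub[of G] by (simp add: out c_in c_out)
      next
        assume "\<exists>H\<in>B1. G = insert y H"
        then obtain H where H: "H \<in> B1" "G = insert y H" by blast
        with that sub[of H] have "int (card H) = i - 1 - 1" by (simp add: card_ins)
        with H sub[of H] cyc show ?thesis by (simp add: inn c_diff)
      qed
      then obtain b where b: "\<And>F. F \<in> B \<Longrightarrow> int (card F) = i \<Longrightarrow> koszul_diff (insert y V) b F = c F"
        using ex unfolding koszul_exact_def by blast
      show "\<exists>b. \<forall>F\<in>B1. int (card F) = i - 1 \<longrightarrow> koszul_diff V b F = c1 F"
      proof (intro exI ballI impI)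
        fix H assume H: "H \<in> B1" "int (card H) = i - 1"
        then have HV: "H \<subseteq> V" using sub by simp
        have "koszul_diff (insert y V) b (insert y H) = c (insert y H)"
          using H HV by (intro b) (auto simp: card_ins B1)
        then have "koszul_sign y H * koszul_diff (insert y V) b (insert y H) = c1 H"
          using c_in[OF HV] by simp
        then show "koszul_diff V (\<lambda>G. - (koszul_sign y G * b (insert y G))) H = c1 H"
          by (simp add: inn HV koszul_diff_uminus)
      qed
    qed
    show "koszul_exact K V B0 i" unfolding koszul_exact_def
    proof (intro allI impI)
      fix c0 :: "nat set \<Rightarrow> 'k"
      assume cyc: "\<forall>G\<in>B0. int (card G) = i - 1 \<longrightarrow> koszul_diff V c0 G = 0"
      define c where "c F = (if y \<in> F then 0 else c0 F)" for F
      have c_out: "koszul_diff V c H = koszul_diff V c0 H" if "H \<subseteq> V" for H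
        using that V by (intro koszul_diff_cong) (auto simp: c_def)
      have "koszul_diff (insert y V) c G = 0" if "G \<in> B" "int (card G) = i - 1" for G
        using split[OF that(1)]
      proof
        assume G: "G \<in> B0"
        then show ?thesis using cyc that sub[of G] by (simp add: out c_out) (simp add: c_def)
      next
        assume "\<exists>H\<in>B1. G = insert y H"
        then obtain H where H: "H \<in> B1" "G = insert y H" by blast
        with sub[of H] show ?thesis by (simp add: inn) (simp add: c_def)
      qed
      then obtain b where b: "\<And>F. F \<in> B \<Longrightarrow> int (card F) = i \<Longrightarrow> koszul_diff (insert y V) b F = c F"
        using ex unfolding koszul_exact_def by blast
      \<comment> \<open>As \<open>c\<close> has no e_y component, \<open>b1\<close> is a cycle on
        \<open>B1\<close> and bounds some \<open>h\<close> on \<open>B0\<close>. There d b + b1 = c0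
        becomes d (b + h) = c0.\<close>
      define b1 where "b1 = (\<lambda>G. koszul_sign y G * b (insert y G))"
      have "koszul_diff V b1 H = 0" if "H \<in> B1" "int (card H) = i - 1" for H
      proof -
        have HV: "H \<subseteq> V" using sub that by simp
        have "koszul_diff (insert y V) b (insert y H) = c (insert y H)"
          using that HV by (intro b) (auto simp: card_ins B1)
        then show ?thesis by (simp add: inn HV c_def b1_def)
      qed
      then obtain h where h: "\<forall>G\<in>B0. int (card G) = i \<longrightarrow> koszul_diff V h G = b1 G"
        using nul[of i b1] by blast
      show "\<exists>b. \<forall>F\<in>B0. int (card F) = i \<longrightarrow> koszul_diff V b F = c0 F"
      proof (intro exI ballI impI)
        fix G assume G: "G \<in> B0" "int (card G) = i"
        then have GV: "G \<subseteq> V" using sub by simp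
        have "koszul_diff (insert y V) b G = c G" using G by (intro b) (auto simp: B0)
        moreover have "y \<notin> G" using GV V by auto
        ultimately show "koszul_diff V (\<lambda>F. b F + h F) G = c0 G"
          using h G by (simp add: out GV koszul_diff_add c_def b1_def)
      qed
    qed
  next
    assume ex: "koszul_exact K V B1 (i - 1) \<and> koszul_exact K V B0 i"
    show "koszul_exact K (insert y V) B i" unfolding koszul_exact_def
    proof (intro allI impI)
      fix c :: "nat set \<Rightarrow> 'k"
      assume cyc: "\<forall>G\<in>B. int (card G) = i - 1 \<longrightarrow> koszul_diff (insert y V) c G = 0"
      define c1 where "c1 = (\<lambda>G. koszul_sign y G * c (insert y G))"
      have "koszul_diff V c1 H = 0" if "H \<in> B1" "int (card H) = i - 1 - 1" for H
      proof -
        have HV: "H \<subseteq> V" using sub that by simp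
        have "koszul_diff (insert y V) c (insert y H) = 0"
          using cyc that HV by (auto simp: card_ins B1)
        then show ?thesis by (simp add: inn HV c1_def)
      qed
      with ex obtain b1 where b1: "\<And>H. H \<in> B1 \<Longrightarrow> int (card H) = i - 1 \<Longrightarrow> koszul_diff V b1 H = c1 H"
        unfolding koszul_exact_def by blast
      \<comment> \<open>On \<open>B0\<close> the cycle condition reads d c + c1 = 0, and c1 = d b1
        there because \<open>B0\<close> lies in \<open>B1\<close>.\<close>
      have "koszul_diff V (\<lambda>F. c F + b1 F) G = 0" if "G \<in> B0" "int (card G) = i - 1" for G
      proof -
        have "koszul_diff (insert y V) c G = 0" using cyc that by (auto simp: B0)
        then show ?thesis using that B01 b1[of G] sub[of G] by (simp add: out koszul_diff_add c1_def)
      qed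
      with ex obtain b0 where b0: "\<And>G. G \<in> B0 \<Longrightarrow> int (card G) = i \<Longrightarrow> koszul_diff V b0 G = c G + b1 G"
        unfolding koszul_exact_def by (metis (no_types, lifting))
      \<comment> \<open>The chain b0 - e_y b1 has boundary (d b0 - b1, d b1) = (c, c1).\<close>
      define b where "b F = (if y \<in> F then - (koszul_sign y (F - {y}) * b1 (F - {y})) else b0 F)" for F
      have b_in: "koszul_sign y H * b (insert y H) = - b1 H" if "H \<subseteq> V" for H
      proof -
        have "insert y H - {y} = H" using that V by auto
        then show ?thesis by (simp add: b_def)
      qed
      have b_out: "koszul_diff V b H = koszul_diff V b0 H" if "H \<subseteq> V" for H
        using that V by (intro koszul_diff_cong) (auto simp: b_def)
      have b_diff: "koszul_diff V (\<lambda>G. koszul_sign y G * b (insert y G)) H = - koszul_diff V b1 H"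
        if "H \<subseteq> V" for H
        unfolding koszul_diff_uminus[symmetric] using that by (intro koszul_diff_cong b_in) auto
      have "koszul_diff (insert y V) b G = c G" if "G \<in> B" "int (card G) = i" for G
        using split[OF that(1)]
      proof
        assume G: "G \<in> B0"
        then show ?thesis using b0 that sub[of G] by (simp add: out b_in b_out)
      next
        assume "\<exists>H\<in>B1. G = insert y H"
        then obtain H where H: "H \<in> B1" "G = insert y H" by blast
        with that sub[of H] have "int (card H) = i - 1" by (simp add: card_ins)
        with H sub[of H] b1[of H] show ?thesis by (simp add: inn b_diff c1_def)
      qed
      then show "\<exists>b. \<forall>F\<in>B. int (card F) = i \<longrightarrow> koszul_diff (insert y V) b F = c F" by blast
    qed
  qed
qed

section \<open>Deletion and link in independence complexes\<close>

text \<open>The complements in \<open>V\<close> of the faces of the link of \<open>A\<close> in the independence complex on \<open>V \<union> A\<close>.\<close>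
definition indep_compl :: "nat set set \<Rightarrow> nat set \<Rightarrow> nat set \<Rightarrow> nat set set" where
  "indep_compl E V A = {F. F \<subseteq> V \<and> \<not> (\<exists>S\<in>E. S \<subseteq> (V - F) \<union> A)}"

text \<open>Up to signs, this says that the reduced cohomology of that link vanishes in dimension \<open>k - 1\<close>,
  that is, on faces with \<open>k\<close> elements.\<close>
definition acyclic_at :: "'k::field itself \<Rightarrow> nat set set \<Rightarrow> nat set \<Rightarrow> nat set \<Rightarrow> int \<Rightarrow> bool" where
  "acyclic_at K E V A k \<longleftrightarrow> koszul_exact K V (indep_compl E V A) (int (card V) - k)"

text \<open>A dependent \<open>A\<close> has a void link, without even the empty face, so the
  complex is zero.\<close>

lemma acyclic_at_edge:
  assumes "S \<in> E" "S \<subseteq> A"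
  shows "acyclic_at K E V A k"
proof -
  have "indep_compl E V A = {}" using assms by (auto simp: indep_compl_def)
  then show ?thesis by (simp add: acyclic_at_def koszul_exact_def)
qed

lemma acyclic_at_cone:
  assumes "finite V" "x \<in> V" "\<And>S. S \<in> E \<Longrightarrow> S \<subseteq> V \<union> A \<Longrightarrow> x \<notin> S"
  shows "acyclic_at K E V A k"
  unfolding acyclic_at_def
proof (rule koszul_exact_cone[OF assms(1,2)])
  show "indep_compl E V A \<subseteq> Pow V" by (auto simp: indep_compl_def)
  fix H assume H: "H \<in> indep_compl E V A" "x \<in> H"
  have False if S: "S \<in> E" "S \<subseteq> (V - (H - {x})) \<union> A" for S
  proof -
    have "x \<notin> S" using assms(3)[OF S(1)] S(2) by blast
    with S have "S \<subseteq> (V - H) \<union> A" by auto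
    with S H show False by (auto simp: indep_compl_def)
  qed
  with H show "H - {x} \<in> indep_compl E V A" by (auto simp: indep_compl_def)
qed

text \<open>Deletion and link of \<open>y\<close>. In the second form of \<open>null\<close>,
  \<open>y\<close> can be exchanged for \<open>x\<close> in independent sets, so the inclusion of
  the link into the deletion factors through a cone with apex \<open>x\<close>; in the first form
  the link is void. Faces of the link have lost \<open>y\<close>, hence
  \<open>k - 1\<close>.\<close>

lemma acyclic_at_split:
  assumes V: "finite V" "y \<notin> V"
    and null: "(\<exists>S\<in>E. S \<subseteq> insert y A) \<or>
      (\<exists>x\<in>V. \<forall>G S. G \<subseteq> V \<and> S \<in> E \<and> S \<subseteq> insert x (G \<union> A) \<longrightarrow> (\<exists>T\<in>E. T \<subseteq> insert y (G \<union> A)))"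
  shows "acyclic_at K E (insert y V) A k \<longleftrightarrow>
    acyclic_at K E V A k \<and> acyclic_at K E V (insert y A) (k - 1)"
proof -
  let ?B = "indep_compl E (insert y V) A"
  have diff: "insert y V - insert y H = V - H" "insert y V - H = insert y (V - H)" if "H \<subseteq> V" for H
    using that V by auto
  have B1: "indep_compl E V A = {H. H \<subseteq> V \<and> insert y H \<in> ?B}"
    using V by (auto simp: indep_compl_def diff)
  have B0: "indep_compl E V (insert y A) = {H. H \<subseteq> V \<and> H \<in> ?B}"
    using V by (auto simp: indep_compl_def diff)
  have null': "indep_compl E V (insert y A) = {} \<or>
     (\<exists>x\<in>V. \<forall>H\<in>indep_compl E V (insert y A). x \<in> H \<longrightarrow> H - {x} \<in> indep_compl E V A)"
    using null
  proof
    assume "\<exists>S\<in>E. S \<subseteq> insert y A"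
    then obtain S where "S \<in> E" "S \<subseteq> insert y A" by blast
    then have "S \<subseteq> (V - F) \<union> insert y A" for F by blast
    with \<open>S \<in> E\<close> have "indep_compl E V (insert y A) = {}" unfolding indep_compl_def by blast
    then show ?thesis ..
  next
    assume "\<exists>x\<in>V. \<forall>G S. G \<subseteq> V \<and> S \<in> E \<and> S \<subseteq> insert x (G \<union> A) \<longrightarrow> (\<exists>T\<in>E. T \<subseteq> insert y (G \<union> A))"
    then obtain x where x: "x \<in> V"
      and swap: "\<forall>G S. G \<subseteq> V \<and> S \<in> E \<and> S \<subseteq> insert x (G \<union> A) \<longrightarrow> (\<exists>T\<in>E. T \<subseteq> insert y (G \<union> A))"
      by (rule bexE)
    have "H - {x} \<in> indep_compl E V A" if H: "H \<in> indep_compl E V (insert y A)" "x \<in> H" for H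
    proof -
      have False if S: "S \<in> E" "S \<subseteq> (V - (H - {x})) \<union> A" for S
      proof -
        have "S \<subseteq> insert x ((V - H) \<union> A)" using S by auto
        then obtain T where "T \<in> E" "T \<subseteq> insert y ((V - H) \<union> A)"
          using swap[rule_format, of "V - H" S] S(1) by blast
        with H(1) show False by (auto simp: indep_compl_def)
      qed
      with H show ?thesis by (auto simp: indep_compl_def)
    qed
    with x show ?thesis by blast
  qed
  have sub: "?B \<subseteq> Pow (insert y V)" by (auto simp: indep_compl_def)
  have up: "insert y F \<in> ?B" if F: "F \<in> ?B" for F
  proof -
    have "S \<subseteq> insert y V - F \<union> A" if "S \<subseteq> insert y V - insert y F \<union> A" for S
      using that by auto
    moreover have "insert y F \<subseteq> insert y V" using F by (simp add: indep_compl_def subset_insertI2)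
    ultimately show ?thesis using F unfolding indep_compl_def by (simp only: mem_Collect_eq) meson
  qed
  have "koszul_exact K (insert y V) ?B i \<longleftrightarrow> koszul_exact K V (indep_compl E V A) (i - 1)
      \<and> koszul_exact K V (indep_compl E V (insert y A)) i" for i
    by (rule koszul_exact_split[OF V sub up B0 B1 null'])
  with V show ?thesis by (simp add: acyclic_at_def algebra_simps)
qed

text \<open>In the splitting at \<open>z\<close> the link term is void because of the edge
  \<open>insert z A\<close>; only the deletion remains.\<close>

lemma acyclic_at_remove_forced:
  assumes "finite V" "P \<subseteq> V" "\<And>z. z \<in> P \<Longrightarrow> insert z A \<in> E"
  shows "acyclic_at K E V A k \<longleftrightarrow> acyclic_at K E (V - P) A k"
proof -
  have "finite P" using assms finite_subset by blast
  then show ?thesis using assms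
  proof (induction P arbitrary: V)
    case (insert z P)
    define W where "W = V - {z}"
    have W: "finite W" "z \<notin> W" "V = insert z W" "P \<subseteq> W" using insert by (auto simp: W_def)
    have e: "insert z A \<in> E" using insert by auto
    have "acyclic_at K E (insert z W) A k
        \<longleftrightarrow> acyclic_at K E W A k \<and> acyclic_at K E W (insert z A) (k - 1)"
      using W e by (intro acyclic_at_split) auto
    moreover have "acyclic_at K E W (insert z A) (k - 1)" using e by (rule acyclic_at_edge) simp
    moreover have "acyclic_at K E W A k \<longleftrightarrow> acyclic_at K E (W - P) A k"
      using insert W by (intro insert.IH) auto
    moreover have "V - insert z P = W - P" by (auto simp: W_def)
    ultimately show ?case using W by simp
  qed simp
qed

text \<open>The complex whose only face is empty has reduced cohomology in dimension -1 alone, which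
  is \<open>k = 0\<close>.\<close>

lemma acyclic_at_empty:
  assumes "{} \<notin> E"
  shows "acyclic_at K E {} {} k \<longleftrightarrow> k \<noteq> 0"
proof -
  have B: "indep_compl E {} {} = {{}}" using assms by (auto simp: indep_compl_def)
  have "\<exists>c::nat set \<Rightarrow> 'a. c {} \<noteq> 0" by (rule exI[of _ "\<lambda>_. 1"]) simp
  then show ?thesis by (auto simp: acyclic_at_def koszul_exact_def B koszul_diff_def)
qed

section \<open>Self disjoint sets\<close>

lemma self_disj_auxE:
  assumes "self_disj_aux P E \<S>"
  obtains \<S>0 where "\<S> \<subseteq> E" "\<forall>T\<in>\<S>. \<not> T \<subseteq> \<Union>(\<S> - {T})" "\<S>0 \<subseteq> \<S>" "P E \<S>0"
    "\<forall>T\<in>\<S> - \<S>0. \<exists>S'\<in>\<S>0. card (T - S') = 1"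
proof -
  from assms have S: "\<S> \<subseteq> E" "\<forall>T\<in>\<S>. \<not> T \<subseteq> \<Union>(\<S> - {T})"
    and ex: "\<exists>\<S>0. \<S>0 \<subseteq> \<S> \<and> P E \<S>0 \<and> (\<forall>T\<in>\<S> - \<S>0. \<exists>S'\<in>\<S>0. card (T - S') = 1)"
    unfolding self_disj_aux_def by simp_all
  from ex obtain \<S>0 where "\<S>0 \<subseteq> \<S> \<and> P E \<S>0 \<and> (\<forall>T\<in>\<S> - \<S>0. \<exists>S'\<in>\<S>0. card (T - S') = 1)"
    by (rule exE)
  with S show ?thesis by (intro that[of \<S>0]) simp_all
qed

lemma self_disj_auxI:
  assumes "\<S> \<subseteq> E" "\<And>T. T \<in> \<S> \<Longrightarrow> \<not> T \<subseteq> \<Union>(\<S> - {T})" "\<S>0 \<subseteq> \<S>" "P E \<S>0"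
    "\<And>T. T \<in> \<S> - \<S>0 \<Longrightarrow> \<exists>S'\<in>\<S>0. card (T - S') = 1"
  shows "self_disj_aux P E \<S>"
  unfolding self_disj_aux_def using assms by (intro conjI ballI exI[of _ \<S>0]) simp_all

definition petals :: "nat set set \<Rightarrow> nat set \<Rightarrow> nat set \<Rightarrow> nat set" where
  "petals E V C = {z \<in> V. insert z C \<in> E}"

locale sunflower_hypergraph =
  fixes d :: nat and E :: "nat set set"
  assumes two_le_d: "2 \<le> d"
    and card_edge: "\<And>S. S \<in> E \<Longrightarrow> card S = d"
    and card_meet: "\<And>S T. S \<in> E \<Longrightarrow> T \<in> E \<Longrightarrow> S \<noteq> T \<Longrightarrow> S \<inter> T \<noteq> {} \<Longrightarrow> card (S \<inter> T) = d - 1"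
begin

lemma finite_edge: "S \<in> E \<Longrightarrow> finite S"
  using card_edge two_le_d by (metis card.infinite not_numeral_le_zero)

lemma empty_not_edge: "{} \<notin> E"
  using card_edge two_le_d by fastforce

lemma petals_disjoint:
  assumes "card C = d - 1"
  shows "C \<inter> petals E V C = {}"
proof -
  have "insert z C \<noteq> C" if "insert z C \<in> E" for z
    using card_edge[OF that] assms two_le_d by auto
  then show ?thesis by (auto simp: petals_def insert_absorb)
qed

text \<open>The intersection condition at work: without \<open>x\<close>, the edge \<open>T\<close>
  can meet \<open>insert x C\<close> only inside \<open>C\<close>, and \<open>d - 1\<close> common
  vertices fill all of \<open>C\<close>.\<close>

lemma edge_meets_core:
  assumes C: "card C = d - 1" and x: "insert x C \<in> E" and T: "T \<in> E" "x \<notin> T" "T \<inter> C \<noteq> {}"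
  obtains z where "T = insert z C" "z \<notin> C"
proof -
  have fC: "finite C" using finite_edge[OF x] by simp
  have "T \<noteq> insert x C" using T by auto
  moreover have TC: "T \<inter> insert x C = T \<inter> C" using T by auto
  ultimately have "card (T \<inter> C) = d - 1" using card_meet[OF T(1) x] T by auto
  then have "T \<inter> C = C" using C fC by (intro card_subset_eq) auto
  then have CT: "C \<subseteq> T" by auto
  then have "card (T - C) = 1" using card_Diff_subset[OF fC CT] card_edge[OF T(1)] C two_le_d by simp
  then obtain z where "T - C = {z}" by (auto simp: card_1_singleton_iff)
  with CT have "T = insert z C" "z \<notin> C" by auto
  with that show ?thesis by blast
qed

text \<open>Each edge outside the matching contributes exactly one vertex, its private one.\<close>
lemma self_disjoint_card:
  assumes S: "\<S> \<subseteq> E" and priv: "\<And>T. T \<in> \<S> \<Longrightarrow> \<not> T \<subseteq> \<Union>(\<S> - {T})"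
    and S0: "\<S>0 \<subseteq> \<S>" "induced_matching E \<S>0"
    and att: "\<And>T. T \<in> \<S> - \<S>0 \<Longrightarrow> \<exists>S'\<in>\<S>0. card (T - S') = 1"
    and fin: "finite (\<Union>\<S>)"
  shows "card \<S> + (d - 1) * card \<S>0 = card (\<Union>\<S>)"
proof -
  have fS: "finite \<S>" using fin by (rule finite_UnionD)
  then have fS0: "finite \<S>0" using S0(1) finite_subset by blast
  have cU: "card (\<Union>\<S>0) = card \<S>0 * d"
  proof -
    have "card (\<Union>\<S>0) = (\<Sum>T\<in>\<S>0. card T)"
      using S0 S finite_edge
      by (intro card_Union_disjoint) (auto simp: induced_matching_def pairwise_def disjnt_def)
    also have "\<dots> = (\<Sum>T\<in>\<S>0. d)" using S0 S card_edge by (intro sum.cong) auto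
    finally show ?thesis by simp
  qed
  \<comment> \<open>The matching edge \<open>S'\<close> covers all of \<open>T\<close> but
    \<open>w\<close>. If another edge contained \<open>w\<close>, then \<open>T\<close> would have
    no private vertex.\<close>
  have single: "\<exists>w. T - \<Union>\<S>0 = {w} \<and> w \<notin> \<Union>(\<S> - {T})" if T: "T \<in> \<S> - \<S>0" for T
  proof -
    obtain S' where S': "S' \<in> \<S>0" "card (T - S') = 1" using att[OF T] by blast
    then obtain w where w: "T - S' = {w}" by (auto simp: card_1_singleton_iff)
    have U: "\<Union>\<S>0 \<subseteq> \<Union>(\<S> - {T})" using T S0(1) by auto
    have "w \<notin> \<Union>(\<S> - {T})"
    proof
      assume "w \<in> \<Union>(\<S> - {T})"
      moreover have "S' \<subseteq> \<Union>(\<S> - {T})" using S' U by auto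
      moreover have "T \<subseteq> insert w S'" using w by auto
      ultimately have "T \<subseteq> \<Union>(\<S> - {T})" by blast
      with priv T show False by blast
    qed
    moreover from this U w S'(1) have "T - \<Union>\<S>0 = {w}" by auto
    ultimately show ?thesis by blast
  qed
  have "\<Union>\<S> - \<Union>\<S>0 = (\<Union>T\<in>\<S> - \<S>0. T - \<Union>\<S>0)" by auto
  also have "card \<dots> = (\<Sum>T\<in>\<S> - \<S>0. card (T - \<Union>\<S>0))"
  proof (rule card_UN_disjoint)
    show "\<forall>T\<in>\<S> - \<S>0. finite (T - \<Union>\<S>0)" using S finite_edge by auto
    show "\<forall>T\<in>\<S> - \<S>0. \<forall>T'\<in>\<S> - \<S>0. T \<noteq> T' \<longrightarrow> (T - \<Union>\<S>0) \<inter> (T' - \<Union>\<S>0) = {}"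
    proof (intro ballI impI)
      fix T T' assume T: "T \<in> \<S> - \<S>0" "T' \<in> \<S> - \<S>0" "T \<noteq> T'"
      obtain w where "T - \<Union>\<S>0 = {w}" "w \<notin> \<Union>(\<S> - {T})" using single[OF T(1)] by blast
      with T show "(T - \<Union>\<S>0) \<inter> (T' - \<Union>\<S>0) = {}" by auto
    qed
  qed (use fS in simp)
  also have "\<dots> = (\<Sum>T\<in>\<S> - \<S>0. 1)" using single by (intro sum.cong) force+
  also have "\<dots> = card \<S> - card \<S>0" using card_Diff_subset[OF fS0 S0(1)] by simp
  finally have "card (\<Union>\<S> - \<Union>\<S>0) = card \<S> - card \<S>0" .
  moreover have "card (\<Union>\<S> - \<Union>\<S>0) = card (\<Union>\<S>) - card (\<Union>\<S>0)"
    using S0(1) finite_subset[OF Union_mono[OF S0(1)] fin] by (intro card_Diff_subset) auto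
  moreover have "card (\<Union>\<S>0) \<le> card (\<Union>\<S>)" using S0(1) fin by (intro card_mono) auto
  moreover have "card \<S>0 \<le> card \<S>" using S0(1) fS by (intro card_mono)
  moreover have "card \<S>0 * d = card \<S>0 + (d - 1) * card \<S>0"
    using two_le_d by (simp add: algebra_simps diff_mult_distrib2 diff_mult_distrib)
  ultimately show ?thesis using cU by linarith
qed

section \<open>Removing the neighbours of a simplicial vertex\<close>

context
  fixes V0 :: "nat set" and x :: nat and N :: "nat set"
  assumes fin: "finite V0" and x: "x \<in> V0" and simplicial: "simplicial d (induced_edges E V0) x"
    and N_def: "N = nbhd (induced_edges E V0) x"
begin

lemma nbhd_facts: "x \<notin> N" "N \<subseteq> V0" "finite N"
proof -
  show "x \<notin> N" and sub: "N \<subseteq> V0" by (auto simp: N_def nbhd_def induced_edges_def)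
  show "finite N" using sub fin by (rule finite_subset)
qed

lemma simplicial_edge:
  assumes "T \<subseteq> insert x N" "card T = d"
  shows "T \<in> E"
proof -
  have "T \<subseteq> closed_nbhd (induced_edges E V0) x" using assms(1) by (simp add: closed_nbhd_def N_def)
  then have "T \<in> induced_edges E V0" using simplicial assms(2) unfolding simplicial_def by simp
  then show ?thesis by (simp add: induced_edges_def)
qed

lemma edge_subset_nbhd: "S \<in> E \<Longrightarrow> S \<subseteq> V0 \<Longrightarrow> x \<in> S \<Longrightarrow> S - {x} \<subseteq> N"
  by (auto simp: N_def nbhd_def induced_edges_def)

lemma insert_edge:
  assumes "C \<subseteq> N" "card C = d - 1" "b \<in> insert x N" "b \<notin> C"
  shows "insert b C \<in> E"
proof (rule simplicial_edge)
  have "finite C" using assms(1) nbhd_facts finite_subset by blast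
  then show "card (insert b C) = d" using assms two_le_d by simp
qed (use assms in auto)

text \<open>The end of the peeling, where the link of a full core \<open>C\<close> is reached.
  Neighbours already removed from \<open>V\<close> lie in \<open>C\<close> or among the petals, the
  remaining petals are forced out, and by \<open>edge_meets_core\<close> no edge left over touches
  \<open>C\<close>; so the link is the whole complex on the remaining vertices.\<close>

lemma acyclic_at_core:
  assumes C: "C \<subseteq> N" "card C = d - 1" and V: "V \<subseteq> V0" "C \<inter> V = {}" "x \<in> V" "V0 - V \<subseteq> N"
  shows "acyclic_at K E V C k \<longleftrightarrow> acyclic_at K E (V0 - C - petals E V0 C) {} k"
proof -
  let ?P = "petals E V0 C" and ?W = "V0 - C - petals E V0 C"
  have xC: "insert x C \<in> E" using C nbhd_facts by (intro insert_edge) auto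
  have xP: "x \<in> ?P" using x xC by (simp add: petals_def)
  have "V0 - V \<subseteq> C \<union> ?P"
  proof
    fix b assume b: "b \<in> V0 - V"
    then have "insert b C \<in> E" if "b \<notin> C" using that V C by (intro insert_edge) auto
    with b show "b \<in> C \<union> ?P" by (auto simp: petals_def)
  qed
  then have W: "V - (?P \<inter> V) = ?W" using V by auto
  have "acyclic_at K E V C k \<longleftrightarrow> acyclic_at K E (V - (?P \<inter> V)) C k"
    using V fin finite_subset by (intro acyclic_at_remove_forced) (auto simp: petals_def)
  also have "\<dots> \<longleftrightarrow> acyclic_at K E ?W C k" by (simp only: W)
  also have "\<dots> \<longleftrightarrow> acyclic_at K E ?W {} k"
  proof -
    have "T \<inter> C = {}" if T: "T \<in> E" "T \<subseteq> ?W \<union> C" for T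
    proof (rule ccontr)
      assume "T \<inter> C \<noteq> {}"
      moreover have "x \<notin> T" using T(2) xP C nbhd_facts by auto
      ultimately obtain z where z: "T = insert z C" "z \<notin> C"
        using edge_meets_core[OF C(2) xC T(1)] by blast
      with T have "z \<in> V0" "z \<notin> ?P" by auto
      with T z show False by (simp add: petals_def)
    qed
    then have "S \<subseteq> ?W - F \<union> C \<longleftrightarrow> S \<subseteq> ?W - F" if "S \<in> E" for S F using that by blast
    then have "indep_compl E ?W C = indep_compl E ?W {}"
      by (auto simp: indep_compl_def)
    then show ?thesis by (simp add: acyclic_at_def)
  qed
  finally show ?thesis .
qed

text \<open>Induction on the neighbours still in \<open>V\<close>: \<open>A\<close> collects those
  moved into the link, the others outside \<open>V\<close> were deleted, and \<open>C\<close> runs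
  over the ways to complete \<open>A\<close> to a core. Each vertex still missing from
  \<open>A\<close> lowers the degree by one.\<close>

lemma acyclic_at_recursion_gen:
  assumes "V \<subseteq> V0" "A \<subseteq> N" "A \<inter> V = {}" "x \<in> V" "V0 - V \<subseteq> N" "card A \<le> d - 1"
  shows "acyclic_at K E V A k \<longleftrightarrow> (\<forall>C. A \<subseteq> C \<and> C \<subseteq> A \<union> (V \<inter> N) \<and> card C = d - 1 \<longrightarrow>
    acyclic_at K E (V0 - C - petals E V0 C) {} (k - (int d - 1 - int (card A))))"
  using assms
proof (induction "card (V \<inter> N)" arbitrary: V A k rule: less_induct)
  case less
  have fA: "finite A" and fV: "finite V"
    using less.prems nbhd_facts fin finite_subset by blast+
  \<comment> \<open>Either the core is complete; or no neighbours are left and \<open>x\<close> is a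
    cone point, since an edge through \<open>x\<close> would need \<open>d - 1\<close> vertices of
    \<open>A\<close>; or a neighbour \<open>y\<close> can be split off.\<close>
  consider "card A = d - 1" | "card A < d - 1" "V \<inter> N = {}" | y where "card A < d - 1" "y \<in> V \<inter> N"
    using less.prems(6) by fastforce
  then show ?case
  proof cases
    case 1
    have "C = A" if "A \<subseteq> C" "C \<subseteq> A \<union> (V \<inter> N)" "card C = d - 1" for C
    proof -
      have "finite C" using that fA fV finite_subset[of C] by auto
      then show ?thesis using that 1 card_subset_eq[of C A] by simp
    qed
    moreover have "k - (int d - 1 - int (card A)) = k" using 1 two_le_d by simp
    ultimately show ?thesis
      using acyclic_at_core[OF less.prems(2) 1 less.prems(1,3,4,5), of K k] 1 by auto
  next
    case 2
    have "acyclic_at K E V A k"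
    proof (rule acyclic_at_cone[OF fV less.prems(4)])
      fix S assume S: "S \<in> E" "S \<subseteq> V \<union> A"
      show "x \<notin> S"
      proof
        assume xS: "x \<in> S"
        have "S \<subseteq> V0" using S(2) less.prems(1,2) nbhd_facts(2) by blast
        then have "S - {x} \<subseteq> N" using S(1) xS by (intro edge_subset_nbhd)
        then have "S - {x} \<subseteq> A" using S 2 by auto
        then have "card (S - {x}) < d - 1" using 2 fA card_mono le_less_trans by blast
        then show False using xS card_edge[OF S(1)] by simp
      qed
    qed
    moreover have "\<not> (A \<subseteq> C \<and> C \<subseteq> A \<union> (V \<inter> N) \<and> card C = d - 1)" for C
      using 2 by auto
    ultimately show ?thesis by blast
  next
    case (3 y)
    define W where "W = V - {y}"
    have yA: "y \<notin> A" and yx: "y \<noteq> x" using 3 less.prems nbhd_facts by auto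
    have W: "finite W" "y \<notin> W" and VW: "V = insert y W" using 3 fV by (auto simp: W_def)
    have WN: "card (W \<inter> N) < card (V \<inter> N)"
      using 3 fV by (intro psubset_card_mono) (auto simp: W_def)
    have xW: "x \<in> W" using less.prems yx by (simp add: W_def)
    have "acyclic_at K E (insert y W) A k \<longleftrightarrow>
        acyclic_at K E W A k \<and> acyclic_at K E W (insert y A) (k - 1)"
    \<comment> \<open>An edge through \<open>x\<close> inside \<open>V0\<close> lies in the closed
      neighbourhood of \<open>x\<close>, so replacing \<open>x\<close> by \<open>y\<close> gives an
      edge by simpliciality.\<close>
    proof (rule acyclic_at_split[OF W], rule disjI2, rule bexI[OF _ xW], intro allI impI, elim conjE)
      fix G S assume G: "G \<subseteq> W" and S: "S \<in> E" "S \<subseteq> insert x (G \<union> A)"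
      show "\<exists>T\<in>E. T \<subseteq> insert y (G \<union> A)"
      proof (cases "x \<in> S")
        case True
        have "S \<subseteq> V0"
          using S(2) G less.prems(1,2,4) nbhd_facts(2) unfolding VW by blast
        then have SN: "S - {x} \<subseteq> N" using S(1) True by (intro edge_subset_nbhd)
        have "y \<notin> S" using S G W yA yx by auto
        have fS: "finite S" by (rule finite_edge[OF S(1)])
        have "insert y (S - {x}) \<in> E"
        proof (rule simplicial_edge)
          show "insert y (S - {x}) \<subseteq> insert x N" using SN 3 by auto
          show "card (insert y (S - {x})) = d"
            using \<open>y \<notin> S\<close> fS True card_edge[OF S(1)] two_le_d by simp
        qed
        moreover have "insert y (S - {x}) \<subseteq> insert y (G \<union> A)" using S(2) by auto
        ultimately show ?thesis by (rule bexI[rotated])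
      next
        case False
        then have "S \<subseteq> insert y (G \<union> A)" using S(2) by auto
        with S(1) show ?thesis by (intro bexI)
      qed
    qed
    also have "acyclic_at K E W A k \<longleftrightarrow> (\<forall>C. A \<subseteq> C \<and> C \<subseteq> A \<union> (W \<inter> N) \<and> card C = d - 1 \<longrightarrow>
        acyclic_at K E (V0 - C - petals E V0 C) {} (k - (int d - 1 - int (card A))))"
      using less.prems 3 xW by (intro less.hyps[OF WN]) (auto simp: W_def)
    also have "acyclic_at K E W (insert y A) (k - 1) \<longleftrightarrow>
        (\<forall>C. insert y A \<subseteq> C \<and> C \<subseteq> insert y A \<union> (W \<inter> N) \<and> card C = d - 1 \<longrightarrow>
        acyclic_at K E (V0 - C - petals E V0 C) {} (k - 1 - (int d - 1 - int (card (insert y A)))))"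
      using less.prems 3 xW yA fA by (intro less.hyps[OF WN]) (auto simp: W_def)
    also have "k - 1 - (int d - 1 - int (card (insert y A))) = k - (int d - 1 - int (card A))"
      using yA fA by simp
    also have "((\<forall>C. A \<subseteq> C \<and> C \<subseteq> A \<union> (W \<inter> N) \<and> card C = d - 1 \<longrightarrow>
        acyclic_at K E (V0 - C - petals E V0 C) {} (k - (int d - 1 - int (card A)))) \<and>
        (\<forall>C. insert y A \<subseteq> C \<and> C \<subseteq> insert y A \<union> (W \<inter> N) \<and> card C = d - 1 \<longrightarrow>
        acyclic_at K E (V0 - C - petals E V0 C) {} (k - (int d - 1 - int (card A))))) \<longleftrightarrow>
        (\<forall>C. A \<subseteq> C \<and> C \<subseteq> A \<union> (V \<inter> N) \<and> card C = d - 1 \<longrightarrow>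
        acyclic_at K E (V0 - C - petals E V0 C) {} (k - (int d - 1 - int (card A))))"
    proof -
      \<comment> \<open>Cores avoiding \<open>y\<close> come from the deletion, those containing
        \<open>y\<close> from the link.\<close>
      have range: "A \<subseteq> C \<and> C \<subseteq> A \<union> (V \<inter> N) \<and> card C = d - 1 \<longleftrightarrow>
          A \<subseteq> C \<and> C \<subseteq> A \<union> (W \<inter> N) \<and> card C = d - 1 \<or>
          insert y A \<subseteq> C \<and> C \<subseteq> insert y A \<union> (W \<inter> N) \<and> card C = d - 1" for C
        using 3 by (auto simp: W_def)
      show ?thesis by (simp only: range imp_disjL all_conj_distrib)
    qed
    finally show ?thesis by (simp only: VW)
  qed
qed

lemma acyclic_at_recursion:
  "acyclic_at K E V0 {} k \<longleftrightarrow> (\<forall>C \<subseteq> N. card C = d - 1 \<longrightarrow>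
    acyclic_at K E (V0 - C - petals E V0 C) {} (k - (int d - 1)))"
  using acyclic_at_recursion_gen[of V0 "{}" K k] x nbhd_facts(2) by (auto simp: Int_absorb1)

lemma card_core_petals:
  assumes C: "C \<subseteq> N" "card C = d - 1"
  shows "card (V0 - C - petals E V0 C) + card (petals E V0 C) + (d - 1) = card V0"
proof -
  let ?P = "petals E V0 C"
  have sub: "C \<union> ?P \<subseteq> V0" using C nbhd_facts by (auto simp: petals_def)
  then have fU: "finite (C \<union> ?P)" using fin finite_subset by blast
  have "card (C \<union> ?P) = (d - 1) + card ?P"
    using card_Un_disjoint[of C ?P] petals_disjoint[OF C(2)] fU C(2) by simp
  moreover have "V0 - C - ?P = V0 - (C \<union> ?P)" by auto
  ultimately show ?thesis
    using card_Diff_subset[OF fU sub] card_mono[OF fin sub] by simp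
qed

text \<open>The star of all \<open>insert z C\<close> with \<open>z\<close> a petal is added. Each
  \<open>z\<close> is private to its edge, as the old edges avoid \<open>C\<close> and the petals.
  Only the edge through \<open>x\<close> joins the matching; the other new edges attach to
  it.\<close>

lemma self_disjoint_extend:
  assumes C: "C \<subseteq> N" "card C = d - 1"
    and R: "self_disjoint E \<R>" "\<Union>\<R> = V0 - C - petals E V0 C"
  obtains \<S> where "self_disjoint E \<S>" "\<Union>\<S> = V0" "card \<S> = card \<R> + card (petals E V0 C)"
proof -
  define P where "P = petals E V0 C"
  define S where "S = insert x C"
  define Q where "Q = (\<lambda>z. insert z C) ` P"
  have xC: "x \<notin> C" and CV: "C \<subseteq> V0" using C nbhd_facts by auto
  have S: "S \<in> E" unfolding S_def using C xC by (intro insert_edge) auto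
  have xP: "x \<in> P" using x S by (simp add: P_def S_def petals_def)
  have CP: "C \<inter> P = {}" unfolding P_def by (rule petals_disjoint[OF C(2)])
  have PV: "P \<subseteq> V0" and PE: "\<And>z. z \<in> P \<Longrightarrow> insert z C \<in> E" by (auto simp: P_def petals_def)
  have R_sub: "T \<subseteq> V0" "T \<inter> C = {}" "T \<inter> P = {}" if "T \<in> \<R>" for T
    using R(2) that by (auto simp: P_def)
  have QR: "Q \<inter> \<R> = {}" using R_sub(3) by (auto simp: Q_def)
  have "inj_on (\<lambda>z. insert z C) P" using CP by (auto intro!: inj_onI)
  then have cQ: "card Q = card P" unfolding Q_def by (rule card_image)
  have fP: "finite P" using PV fin by (rule finite_subset)
  have "\<R> \<subseteq> Pow V0" using R_sub(1) by auto
  then have fR: "finite \<R>" using fin finite_subset by blast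
  have UQ: "\<Union>Q = C \<union> P" using xP by (auto simp: Q_def)
  obtain \<R>0 where \<R>: "\<R> \<subseteq> E" "\<forall>T\<in>\<R>. \<not> T \<subseteq> \<Union>(\<R> - {T})"
    and \<R>0: "\<R>0 \<subseteq> \<R>" "induced_matching E \<R>0"
      "\<forall>T\<in>\<R> - \<R>0. \<exists>S'\<in>\<R>0. card (T - S') = 1"
    using R(1) unfolding self_disjoint_def by (rule self_disj_auxE)
  have R0_sub: "\<Union>\<R>0 \<subseteq> V0 - C - P" using \<R>0(1) R(2) by (auto simp: P_def)
  let ?F = "\<R> \<union> Q" and ?M = "insert S \<R>0"
  have priv: "\<not> T \<subseteq> \<Union>(?F - {T})" if "T \<in> ?F" for T
    using that
  proof
    assume T: "T \<in> \<R>"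
    show ?thesis
    proof
      assume "T \<subseteq> \<Union>(?F - {T})"
      moreover have "T \<inter> \<Union>Q = {}" using R_sub[OF T] UQ by auto
      moreover have "\<Union>(?F - {T}) \<subseteq> \<Union>(\<R> - {T}) \<union> \<Union>Q" by auto
      ultimately have "T \<subseteq> \<Union>(\<R> - {T})" by blast
      with \<R>(2)[rule_format, OF T] show False ..
    qed
  next
    assume "T \<in> Q"
    then obtain z where z: "z \<in> P" "T = insert z C" by (auto simp: Q_def)
    have "z \<notin> \<Union>(?F - {T})" using z CP R_sub(3) by (auto simp: Q_def)
    with z show ?thesis by auto
  qed
  have S0S: "?M \<subseteq> ?F" using \<R>0(1) xP by (auto simp: S_def Q_def)
  \<comment> \<open>An edge inside \<open>\<Union>?M\<close> through \<open>x\<close> other than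
    \<open>S\<close> contains a neighbour \<open>w\<close> of \<open>x\<close> covered by
    \<open>\<R>0\<close>; simpliciality makes \<open>w\<close> a petal, but \<open>\<R>0\<close>
    covers no petal. Without \<open>x\<close> the edge either meets \<open>C\<close> and is
    \<open>insert z C\<close> for a petal \<open>z\<close>, or lies inside
    \<open>\<Union>\<R>0\<close>.\<close>
  have im: "induced_matching E ?M"
    unfolding induced_matching_def semi_induced_matching_def
  proof (intro conjI ballI impI)
    show "?M \<subseteq> E" using S \<R>0(1) \<R>(1) by auto
    fix T assume T: "T \<in> E - ?M"
    show "\<not> T \<subseteq> \<Union>?M"
    proof
      assume sub: "T \<subseteq> \<Union>?M"
      then have TV: "T \<subseteq> V0" using R0_sub x CV by (auto simp: S_def)
      show False
      proof (cases "x \<in> T")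
        case True
        have "\<not> T \<subseteq> S"
          using T S card_edge finite_edge card_subset_eq[of S T] by auto
        then obtain w where w: "w \<in> T" "w \<notin> S" by auto
        with sub have "w \<in> \<Union>\<R>0" by auto
        then have wP: "w \<in> V0" "w \<notin> C" "w \<notin> P" using R0_sub by auto
        have "w \<in> N" using edge_subset_nbhd[of T] T TV True w by (auto simp: S_def)
        then have "insert w C \<in> E" using C wP by (intro insert_edge) auto
        with wP show False by (simp add: P_def petals_def)
      next
        case x: False
        show False
        proof (cases "T \<inter> C = {}")
          case True
          with sub x have "T \<subseteq> \<Union>\<R>0" by (auto simp: S_def)
          with T \<R>0(2) show False by (auto simp: induced_matching_def semi_induced_matching_def)
        next
          case False
          then obtain z where z: "T = insert z C" "z \<notin> C"
            using edge_meets_core[OF C(2) _ _ x] S T by (auto simp: S_def)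
          with T TV have "z \<in> P" by (auto simp: P_def petals_def)
          then have "z \<notin> \<Union>\<R>0" using R0_sub by auto
          with z x sub show False by (auto simp: S_def)
        qed
      qed
    qed
  next
    have disj: "S \<inter> T = {}" if "T \<in> \<R>0" for T
      using R_sub[of T] that \<R>0(1) xP by (auto simp: S_def)
    have disj': "T1 \<inter> T2 = {}" if "T1 \<in> \<R>0" "T2 \<in> \<R>0" "T1 \<noteq> T2" for T1 T2
      using \<R>0(2) that by (simp add: induced_matching_def)
    fix T1 T2 assume "T1 \<in> ?M" "T2 \<in> ?M" "T1 \<noteq> T2"
    then show "T1 \<inter> T2 = {}"
      using disj[of T1] disj[of T2] disj'[of T1 T2] by (elim insertE) (simp_all add: Int_commute)
  qed
  have att: "\<exists>S'\<in>?M. card (T - S') = 1" if "T \<in> ?F - ?M" for T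
  proof (cases "T \<in> \<R>")
    case True
    with that \<R>0(3)[rule_format, of T] show ?thesis by auto
  next
    case False
    with that obtain z where z: "z \<in> P" "T = insert z C" by (auto simp: Q_def)
    with that CP have "T - S = {z}" by (auto simp: S_def)
    then show ?thesis by auto
  qed
  have SE: "?F \<subseteq> E" using \<R>(1) PE by (auto simp: Q_def)
  have "self_disjoint E ?F"
    unfolding self_disjoint_def using SE priv S0S im att by (rule self_disj_auxI)
  moreover have "\<Union>?F = V0"
  proof -
    have "\<Union>?F = (V0 - C - P) \<union> (C \<union> P)" using R(2) UQ by (simp add: P_def)
    then show ?thesis using CV PV by auto
  qed
  moreover have "card ?F = card \<R> + card (petals E V0 C)"
    using card_Un_disjoint[of \<R> Q] fR QR fP cQ by (auto simp: Q_def P_def)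
  ultimately show ?thesis by (rule that)
qed

text \<open>Inverse of adding a star. The core \<open>C\<close> is chosen so that
  \<open>insert x C\<close> is in the family and \<open>insert s C\<close> in its matching. All
  edges meeting \<open>C\<close> or its petals are dropped, and the matching loses only
  \<open>insert s C\<close>. The dropped edges are not listed: counting with
  \<open>self_disjoint_card\<close> before and after gives their number.\<close>

lemma self_disjoint_restrict:
  assumes S: "self_disjoint E \<S>" "\<Union>\<S> = V0"
  obtains C \<R> where "C \<subseteq> N" "card C = d - 1" "self_disjoint E \<R>"
    "\<Union>\<R> = V0 - C - petals E V0 C" "card \<S> = card \<R> + card (petals E V0 C)"
proof -
  obtain \<S>0 where \<S>: "\<S> \<subseteq> E" "\<forall>T\<in>\<S>. \<not> T \<subseteq> \<Union>(\<S> - {T})"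
    and \<S>0: "\<S>0 \<subseteq> \<S>" "induced_matching E \<S>0"
      "\<forall>T\<in>\<S> - \<S>0. \<exists>S'\<in>\<S>0. card (T - S') = 1"
    using S(1) unfolding self_disjoint_def by (rule self_disj_auxE)
  have ind: "T \<in> \<S>0" if "T \<in> E" "T \<subseteq> \<Union>\<S>0" for T
    using \<S>0(2) that by (auto simp: induced_matching_def semi_induced_matching_def)
  have disj: "S1 \<inter> S2 = {}" if "S1 \<in> \<S>0" "S2 \<in> \<S>0" "S1 \<noteq> S2" for S1 S2
    using \<S>0(2) that by (auto simp: induced_matching_def)
  have sub: "T \<subseteq> V0" if "T \<in> \<S>" for T using S(2) that by auto
  obtain T0 where T0: "T0 \<in> \<S>" "x \<in> T0" using S(2) x by auto
  \<comment> \<open>If \<open>T0\<close> is in the matching or attached to a matching edge through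
    \<open>x\<close>, then \<open>s = x\<close> works. Otherwise \<open>T0\<close> adds just
    \<open>x\<close> to its matching edge \<open>S'\<close>; they share a core of
    \<open>d - 1\<close> vertices, and \<open>s\<close> is the rest of \<open>S'\<close>.\<close>
  obtain C s where Cs: "insert x C \<in> \<S>" "insert s C \<in> \<S>0" "x \<notin> C" "s \<notin> C"
  proof (cases "T0 \<in> \<S>0")
    case True
    have "insert x (T0 - {x}) = T0" using T0 by auto
    with True T0 show ?thesis by (intro that[of "T0 - {x}" x]) auto
  next
    case False
    then obtain S' where S': "S' \<in> \<S>0" "card (T0 - S') = 1" using \<S>0(3) T0 by blast
    then obtain w where w: "T0 - S' = {w}" by (auto simp: card_1_singleton_iff)
    show ?thesis
    proof (cases "x \<in> S'")
      case True
      then have "insert x (S' - {x}) = S'" by auto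
      with S' \<S>0(1) show ?thesis by (intro that[of "S' - {x}" x]) auto
    next
      case False
      then have "x \<in> T0 - S'" using T0(2) by simp
      with w have "T0 - S' = {x}" by simp
      then have T0_eq: "T0 = insert x (T0 \<inter> S')" by blast
      have fS': "finite S'" and cS': "card S' = d" using S' \<S>0(1) \<S>(1) finite_edge card_edge by auto
      have "card T0 = d" using T0 \<S>(1) card_edge by auto
      then have "card (T0 \<inter> S') = d - 1"
        using T0_eq fS' False by (metis IntD2 card_insert_disjoint diff_Suc_1 finite_Int)
      then have "card (S' - T0) = 1"
        using fS' cS' two_le_d by (simp add: card_Diff_subset_Int Int_commute)
      then obtain s where "S' - T0 = {s}" by (auto simp: card_1_singleton_iff)
      then have "S' = insert s (T0 \<inter> S')" "s \<notin> T0 \<inter> S'" by auto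
      with T0 T0_eq S' False show ?thesis by (intro that[of "T0 \<inter> S'" s]) auto
    qed
  qed
  define S' where "S' = insert s C"
  define T1 where "T1 = insert x C"
  define P where "P = petals E V0 C"
  have S': "S' \<in> \<S>0" "S' \<in> \<S>" "S' \<in> E" and T1: "T1 \<in> \<S>" "T1 \<in> E"
    using Cs \<S>0(1) \<S>(1) by (auto simp: S'_def T1_def)
  have fC: "finite C" using finite_edge[OF S'(3)] by (simp add: S'_def)
  have cC: "card C = d - 1" using card_edge[OF S'(3)] fC Cs(4) by (simp add: S'_def)
  have C_ne: "C \<noteq> {}" using cC two_le_d by auto
  have CN: "C \<subseteq> N" using edge_subset_nbhd[OF T1(2)] sub[OF T1(1)] Cs(3) by (auto simp: T1_def)
  have CV: "C \<subseteq> V0" using CN nbhd_facts by auto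
  have in_P: "z \<in> P" if "insert z C \<in> E" "z \<in> V0" for z using that by (simp add: P_def petals_def)
  have sP: "s \<in> P" using S'(3) sub[OF S'(2)] by (intro in_P) (auto simp: S'_def)
  have S'U: "S' \<subseteq> C \<union> P" using sP by (auto simp: S'_def)
  have CP: "C \<inter> P = {}" unfolding P_def by (rule petals_disjoint[OF cC])
  have PV: "P \<subseteq> V0" by (auto simp: P_def petals_def)
  define \<R> where "\<R> = {T \<in> \<S>. T \<inter> (C \<union> P) = {}}"
  define \<R>0 where "\<R>0 = \<S>0 - {S'}"
  \<comment> \<open>Another matching edge could only contain a petal \<open>u\<close>. Then
    \<open>insert u C\<close> is covered by the matching, so it belongs to it; as it meets
    \<open>S'\<close> it equals \<open>S'\<close>, which puts \<open>u\<close> in two disjoint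
    edges.\<close>
  have avoid: "S'' \<inter> (C \<union> P) = {}" if S'': "S'' \<in> \<R>0" for S''
  proof (rule ccontr)
    assume "S'' \<inter> (C \<union> P) \<noteq> {}"
    moreover have dj: "S'' \<inter> S' = {}" using disj S'(1) S'' by (auto simp: \<R>0_def)
    ultimately obtain u where u: "u \<in> S''" "u \<in> P" by (auto simp: S'_def)
    then have uC: "insert u C \<in> E" by (simp add: P_def petals_def)
    have "insert u C \<subseteq> \<Union>\<S>0" using u S'' S'(1) by (auto simp: \<R>0_def S'_def)
    with uC have "insert u C \<in> \<S>0" by (rule ind)
    moreover have "insert u C \<inter> S' \<noteq> {}" using C_ne by (auto simp: S'_def)
    ultimately have "insert u C = S'" using disj S'(1) by blast
    with u dj show False by auto
  qed
  have R0R: "\<R>0 \<subseteq> \<R>" using avoid \<S>0(1) by (auto simp: \<R>_def \<R>0_def)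
  have UR: "\<Union>\<R> = V0 - C - P"
  proof
    show "\<Union>\<R> \<subseteq> V0 - C - P" using S(2) by (auto simp: \<R>_def)
    show "V0 - C - P \<subseteq> \<Union>\<R>"
    proof
      fix v assume v: "v \<in> V0 - C - P"
      then obtain T where T: "T \<in> \<S>" "v \<in> T" using S(2) by auto
      show "v \<in> \<Union>\<R>"
      proof (cases "T \<in> \<R>")
        case True
        with T show ?thesis by auto
      next
        case False
        have "T \<noteq> S'" using v T S'U by auto
        with False R0R have "T \<notin> \<S>0" by (auto simp: \<R>0_def)
        with T obtain S'' where S'': "S'' \<in> \<S>0" "card (T - S'') = 1" using \<S>0(3) by blast
        then obtain w where w: "T - S'' = {w}" by (auto simp: card_1_singleton_iff)
        show ?thesis
        proof (cases "S'' = S'")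
          \<comment> \<open>The only vertex of \<open>T\<close> outside \<open>S''\<close> lies in
            \<open>C\<close> or is a petal, so \<open>v\<close> is in \<open>S''\<close>.\<close>
          case False
          then have R0: "S'' \<in> \<R>0" using S'' by (simp add: \<R>0_def)
          from \<open>T \<notin> \<R>\<close> T obtain u where u: "u \<in> T" "u \<in> C \<union> P" by (auto simp: \<R>_def)
          with avoid[OF R0] have "u \<in> T - S''" by auto
          with w have "u = w" by auto
          moreover have "v \<noteq> u" using u v by auto
          ultimately have "v \<in> S''" using w T by auto
          with R0 R0R show ?thesis by auto
        next
          \<comment> \<open>Here \<open>v\<close> is the only vertex of \<open>T\<close> outside
            \<open>S'\<close>. Each case makes \<open>v\<close> a petal or leaves \<open>S'\<close>
            without a private vertex.\<close>
          case True
          have vS': "v \<notin> S'" using v S'U by auto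
          with True w T have Tv: "T - S' = {v}" by auto
          have TE: "T \<in> E" and TV: "T \<subseteq> V0" using T \<S>(1) sub by auto
          have False
          proof (cases "x \<in> T")
            case xT: True
            then have "v \<in> insert x N" using edge_subset_nbhd[OF TE TV xT] T by auto
            then have "insert v C \<in> E" using CN cC v by (intro insert_edge) auto
            with v show False using in_P by auto
          next
            case xT: False
            show False
            proof (cases "T \<inter> C = {}")
              case False
              then obtain z where "T = insert z C"
                using edge_meets_core[OF cC _ TE xT] T1(2) by (auto simp: T1_def)
              with T v have "T = insert v C" by auto
              with TE v show False using in_P by auto
            next
              case True
              \<comment> \<open>Now \<open>T\<close> is the pair \<open>{v, s}\<close>: it covers
                \<open>s\<close>, and \<open>T1\<close> covers \<open>C\<close>, so nothing in
                \<open>S'\<close> is private.\<close>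
              then have "T \<subseteq> {v, s}" using Tv by (auto simp: S'_def)
              moreover have "T \<noteq> {v}" using card_edge[OF TE] two_le_d by auto
              ultimately have sT: "s \<in> T" using T by auto
              then have "x \<noteq> s" using xT by auto
              then have "T1 \<noteq> S'" using Cs(3) by (auto simp: T1_def S'_def)
              moreover have "S' \<subseteq> T \<union> T1" using sT by (auto simp: S'_def T1_def)
              ultimately have "S' \<subseteq> \<Union>(\<S> - {S'})" using T(1) T1(1) \<open>T \<noteq> S'\<close> by blast
              with \<S>(2)[rule_format, OF S'(2)] show False ..
            qed
          qed
          then show ?thesis ..
        qed
      qed
    qed
  qed
  have RE: "\<R> \<subseteq> E" and RS: "\<R> \<subseteq> \<S>" using \<S>(1) by (auto simp: \<R>_def)
  have priv: "\<not> T \<subseteq> \<Union>(\<R> - {T})" if "T \<in> \<R>" for T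
  proof -
    have "\<Union>(\<R> - {T}) \<subseteq> \<Union>(\<S> - {T})" using RS by auto
    with \<S>(2)[rule_format, of T] that RS show ?thesis by (meson subset_iff)
  qed
  have im: "induced_matching E \<R>0"
    unfolding induced_matching_def semi_induced_matching_def
  proof (intro conjI ballI impI)
    show "\<R>0 \<subseteq> E" using R0R RE by auto
    show "T1 \<inter> T2 = {}" if "T1 \<in> \<R>0" "T2 \<in> \<R>0" "T1 \<noteq> T2" for T1 T2
      using disj that by (auto simp: \<R>0_def)
    fix T assume T: "T \<in> E - \<R>0"
    show "\<not> T \<subseteq> \<Union>\<R>0"
    proof
      assume TR: "T \<subseteq> \<Union>\<R>0"
      then have "T \<subseteq> \<Union>\<S>0" by (auto simp: \<R>0_def)
      with T ind have "T = S'" by (auto simp: \<R>0_def)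
      with TR have "S' \<subseteq> \<Union>\<R>0" by simp
      moreover have "\<Union>\<R>0 \<inter> S' = {}" using avoid S'U by blast
      moreover have "S' \<noteq> {}" by (simp add: S'_def)
      ultimately show False by auto
    qed
  qed
  \<comment> \<open>An edge disjoint from \<open>S'\<close> has all its \<open>d\<close> vertices
    outside \<open>S'\<close>, and \<open>d \<noteq> 1\<close>; so its matching edge
    survives.\<close>
  have att: "\<exists>S''\<in>\<R>0. card (T - S'') = 1" if T: "T \<in> \<R> - \<R>0" for T
  proof -
    have dj: "T \<inter> S' = {}" using T S'U by (auto simp: \<R>_def)
    then have "T \<noteq> S'" by (auto simp: S'_def)
    then obtain S'' where S'': "S'' \<in> \<S>0" "card (T - S'') = 1"
      using T RS \<S>0(3)[rule_format, of T] by (auto simp: \<R>0_def)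
    have "T - S' = T" using dj by auto
    then have "card (T - S') = d" using T RE card_edge by auto
    with S'' two_le_d have "S'' \<noteq> S'" by auto
    with S'' show ?thesis by (auto simp: \<R>0_def)
  qed
  have "self_disjoint E \<R>"
    unfolding self_disjoint_def using RE priv R0R im att by (rule self_disj_auxI)
  \<comment> \<open>The matching shrinks by one, which costs \<open>d - 1\<close> in
    \<open>self_disjoint_card\<close>, exactly the size of the core in
    \<open>card_core_petals\<close>.\<close>
  moreover have "card \<S> = card \<R> + card P"
  proof -
    have c1: "card \<S> + (d - 1) * card \<S>0 = card V0"
      using self_disjoint_card[OF \<S>(1) \<S>(2)[rule_format] \<S>0(1,2) \<S>0(3)[rule_format]] S(2) fin by simp
    have c2: "card \<R> + (d - 1) * card \<R>0 = card (V0 - C - P)"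
      using self_disjoint_card[OF RE priv R0R im att] UR fin by simp
    have fS0: "finite \<S>0"
    proof (rule finite_subset)
      show "\<S>0 \<subseteq> Pow V0" using \<S>0(1) S(2) by auto
    qed (use fin in simp)
    have c3: "card \<S>0 = Suc (card \<R>0)"
      using card.remove[OF fS0 S'(1)] by (simp add: \<R>0_def)
    have "card (V0 - C - P) + card P + (d - 1) = card V0"
      unfolding P_def by (rule card_core_petals[OF CN cC])
    with c1 c2 c3 show ?thesis by simp
  qed
  ultimately show ?thesis using that CN cC UR by (simp add: P_def)
qed

end

text \<open>Strong induction on \<open>V\<close>, with \<open>acyclic_at_recursion\<close> on one
  side and \<open>self_disjoint_extend\<close> and \<open>self_disjoint_restrict\<close> on the
  other. Simplicial vertices are assumed for all subsets of \<open>U\<close>, so that they are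
  available for the smaller vertex sets; \<open>k\<close> is an integer because subtracting
  \<open>d - 1\<close> may make it negative.\<close>

theorem acyclic_at_iff:
  assumes tri: "\<And>W. W \<subseteq> U \<Longrightarrow> W \<noteq> {} \<Longrightarrow> \<exists>x\<in>W. simplicial d (induced_edges E W) x"
    and "finite V" "V \<subseteq> U"
  shows "\<not> acyclic_at K E V {} k \<longleftrightarrow>
    (\<exists>\<S>. self_disjoint E \<S> \<and> \<Union>\<S> = V \<and> int (card \<S>) + k = int (card V))"
  using assms(2,3)
proof (induction V arbitrary: k rule: finite_psubset_induct)
  case (psubset V)
  show ?case
  proof (cases "V = {}")
    case True
    have sd: "self_disjoint E {}"
      using empty_not_edge by (auto simp: self_disjoint_def self_disj_aux_def
          induced_matching_def semi_induced_matching_def)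
    have empty: "\<S> = {}" if "self_disjoint E \<S>" "\<Union>\<S> = {}" for \<S>
      using that empty_not_edge by (auto simp: self_disjoint_def self_disj_aux_def)
    have "(\<exists>\<S>. self_disjoint E \<S> \<and> \<Union>\<S> = {} \<and> int (card \<S>) + k = 0) \<longleftrightarrow> k = 0"
    proof
      assume "\<exists>\<S>. self_disjoint E \<S> \<and> \<Union>\<S> = {} \<and> int (card \<S>) + k = 0"
      then show "k = 0" by (auto dest!: empty)
    next
      assume "k = 0"
      with sd show "\<exists>\<S>. self_disjoint E \<S> \<and> \<Union>\<S> = {} \<and> int (card \<S>) + k = 0"
        by (intro exI[of _ "{}"]) simp
    qed
    then show ?thesis
      unfolding True card.empty of_nat_0 acyclic_at_empty[OF empty_not_edge] by (simp only: not_not)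
  next
    case False
    then obtain x where x: "x \<in> V" "simplicial d (induced_edges E V) x"
      using tri psubset.prems by blast
    define N where "N = nbhd (induced_edges E V) x"
    note ctx = psubset.hyps(1) x N_def
    note rec = acyclic_at_recursion[OF ctx, of K k]
    have IH: "\<not> acyclic_at K E (V - C - petals E V C) {} (k - (int d - 1)) \<longleftrightarrow>
      (\<exists>\<R>. self_disjoint E \<R> \<and> \<Union>\<R> = V - C - petals E V C \<and>
        int (card \<R>) + int (card (petals E V C)) + k = int (card V))"
      if C: "C \<subseteq> N" "card C = d - 1" for C
    proof -
      have "C \<noteq> {}" using C two_le_d by auto
      moreover have "C \<subseteq> V" using C nbhd_facts(2)[OF ctx] by auto
      ultimately have "V - C - petals E V C \<subset> V" by auto
      then have "\<not> acyclic_at K E (V - C - petals E V C) {} (k - (int d - 1)) \<longleftrightarrow>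
        (\<exists>\<R>. self_disjoint E \<R> \<and> \<Union>\<R> = V - C - petals E V C \<and>
          int (card \<R>) + (k - (int d - 1)) = int (card (V - C - petals E V C)))"
        using psubset.prems by (intro psubset.IH) auto
      moreover have "int (card (V - C - petals E V C)) + int (card (petals E V C)) + (int d - 1)
          = int (card V)"
        using card_core_petals[OF ctx C] two_le_d by linarith
      then have "int r + (k - (int d - 1)) = int (card (V - C - petals E V C)) \<longleftrightarrow>
          int r + int (card (petals E V C)) + k = int (card V)" for r
        by linarith
      ultimately show ?thesis by simp
    qed
    show ?thesis
    proof
      assume "\<not> acyclic_at K E V {} k"
      then obtain C where C: "C \<subseteq> N" "card C = d - 1"
        and "\<not> acyclic_at K E (V - C - petals E V C) {} (k - (int d - 1))"
        unfolding rec by auto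
      then obtain \<R> where R: "self_disjoint E \<R>" "\<Union>\<R> = V - C - petals E V C"
        and cR: "int (card \<R>) + int (card (petals E V C)) + k = int (card V)"
        unfolding IH[OF C] by (elim exE conjE)
      obtain \<S> where "self_disjoint E \<S>" "\<Union>\<S> = V" "card \<S> = card \<R> + card (petals E V C)"
        using self_disjoint_extend[OF ctx C R] .
      with cR show "\<exists>\<S>. self_disjoint E \<S> \<and> \<Union>\<S> = V \<and> int (card \<S>) + k = int (card V)"
        by (intro exI[of _ \<S>]) simp
    next
      assume "\<exists>\<S>. self_disjoint E \<S> \<and> \<Union>\<S> = V \<and> int (card \<S>) + k = int (card V)"
      then obtain \<S> where S: "self_disjoint E \<S>" "\<Union>\<S> = V"
        and cS: "int (card \<S>) + k = int (card V)" by (elim exE conjE)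
      obtain C \<R> where C: "C \<subseteq> N" "card C = d - 1" and R: "self_disjoint E \<R>"
        "\<Union>\<R> = V - C - petals E V C" "card \<S> = card \<R> + card (petals E V C)"
        using self_disjoint_restrict[OF ctx S] .
      have "\<not> acyclic_at K E (V - C - petals E V C) {} (k - (int d - 1))"
        unfolding IH[OF C] using R cS by (intro exI[of _ \<R>]) simp
      with C show "\<not> acyclic_at K E V {} k" unfolding rec by auto
    qed
  qed
qed

section \<open>Semi-induced versus induced matchings\<close>

lemma card_diff_eq_1:
  assumes "S \<in> E" "T \<in> E" "S \<noteq> T" "S \<inter> T \<noteq> {}"
  shows "card (S - T) = 1"
  using card_Diff_subset_Int[of S T] finite_edge[OF assms(1)] card_edge[OF assms(1)]
    card_meet[OF assms] two_le_d by simp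

text \<open>The same family works with a smaller matching \<open>M\<close>, a maximal pairwise
  disjoint subfamily of the semi-induced one. Distinct edges that meet differ by one vertex, so
  attaching an edge to \<open>M\<close> amounts to meeting \<open>M\<close>.\<close>

lemma self_semi_disjoint_iff:
  assumes fin: "finite E"
  shows "self_semi_disjoint E \<S> \<longleftrightarrow> self_disjoint E \<S>"
proof
  assume "self_disjoint E \<S>"
  then show "self_semi_disjoint E \<S>"
    unfolding self_disjoint_def self_semi_disjoint_def self_disj_aux_def induced_matching_def
    by (elim conjE exE) (intro conjI exI; assumption)
next
  assume "self_semi_disjoint E \<S>"
  then obtain \<S>0 where S: "\<S> \<subseteq> E" and priv: "\<forall>T\<in>\<S>. \<not> T \<subseteq> \<Union>(\<S> - {T})"
    and S0: "\<S>0 \<subseteq> \<S>" and ind: "semi_induced_matching E \<S>0"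
    and att: "\<forall>T\<in>\<S> - \<S>0. \<exists>S'\<in>\<S>0. card (T - S') = 1"
    unfolding self_semi_disjoint_def by (rule self_disj_auxE[of semi_induced_matching E \<S>])
  define D where "D = {M \<in> Pow \<S>0. \<forall>S\<in>M. \<forall>T\<in>M. S \<noteq> T \<longrightarrow> S \<inter> T = {}}"
  have "finite \<S>0" using finite_subset[OF S0 finite_subset[OF S fin]] .
  then have "finite D" by (simp add: D_def)
  moreover have "{} \<in> D" by (simp add: D_def)
  ultimately obtain M where M: "M \<in> D" "\<And>M'. M' \<in> D \<Longrightarrow> M \<subseteq> M' \<Longrightarrow> M = M'"
    using finite_has_maximal[of D] by blast
  have MS: "M \<subseteq> \<S>0" using M(1) by (simp add: D_def)
  have meets: "\<exists>S\<in>M. S \<inter> T \<noteq> {}" if T: "T \<in> \<S>0 - M" for T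
  proof (rule ccontr)
    assume no: "\<not> (\<exists>S\<in>M. S \<inter> T \<noteq> {})"
    then have "insert T M \<in> D" using M(1) T by (auto simp: D_def)
    with M(2)[of "insert T M"] T show False by auto
  qed
  have "induced_matching E M"
    unfolding induced_matching_def semi_induced_matching_def
  proof (intro conjI)
    show "M \<subseteq> E" using MS S0 S by simp
    show "\<forall>S\<in>M. \<forall>T\<in>M. S \<noteq> T \<longrightarrow> S \<inter> T = {}" using M(1) by (simp add: D_def)
    show "\<forall>T\<in>E - M. \<not> T \<subseteq> \<Union>M"
    proof (intro ballI notI)
      fix T assume T: "T \<in> E - M" "T \<subseteq> \<Union>M"
      \<comment> \<open>Such a \<open>T\<close> belongs to the family because the larger matching is
        semi-induced, yet other edges of the family cover it.\<close>
      then have "T \<subseteq> \<Union>\<S>0" using MS by blast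
      with ind T have "T \<in> \<S>" using S0 by (auto simp: semi_induced_matching_def)
      moreover have "\<Union>M \<subseteq> \<Union>(\<S> - {T})" using T MS S0 by blast
      ultimately show False using priv T(2) by (meson subset_trans)
    qed
  qed
  moreover have "\<exists>S'\<in>M. card (T - S') = 1" if T: "T \<in> \<S> - M" for T
  proof (cases "T \<in> \<S>0")
    case True
    with T meets obtain S' where S': "S' \<in> M" "S' \<inter> T \<noteq> {}" by blast
    then have "card (T - S') = 1" using T S S0 MS by (intro card_diff_eq_1) auto
    with S' show ?thesis by blast
  next
    case False
    with T att obtain S' where S': "S' \<in> \<S>0" "card (T - S') = 1" by blast
    show ?thesis
    proof (cases "S' \<in> M")
      case False
      with S' meets obtain S'' where S'': "S'' \<in> M" "S'' \<inter> S' \<noteq> {}" by blast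
      have E: "T \<in> E" "S' \<in> E" "S'' \<in> E" using T S' S'' MS S0 S by auto
      have "T \<noteq> S''" using S'' MS \<open>T \<notin> \<S>0\<close> by auto
      \<comment> \<open>If \<open>T\<close> and \<open>S''\<close> were disjoint, the one vertex of
        \<open>S'\<close> outside \<open>T\<close> would be in \<open>S''\<close>, and
        \<open>T\<close> and \<open>S''\<close> together would cover \<open>S'\<close>.\<close>
      moreover have "T \<inter> S'' \<noteq> {}"
      proof
        assume dj: "T \<inter> S'' = {}"
        have "T \<inter> S' \<noteq> {}"
        proof
          assume "T \<inter> S' = {}"
          then have "T - S' = T" by auto
          with S'(2) card_edge[OF E(1)] two_le_d show False by simp
        qed
        then have "card (S' - T) = 1"
          using E S' \<open>T \<notin> \<S>0\<close> by (intro card_diff_eq_1) auto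
        then obtain w where w: "S' - T = {w}" by (auto simp: card_1_singleton_iff)
        from S''(2) dj w have "w \<in> S''" by auto
        with w have "S' \<subseteq> T \<union> S''" by auto
        moreover have "T \<in> \<S> - {S'}" using T S'(1) \<open>T \<notin> \<S>0\<close> by auto
        moreover have "S'' \<in> \<S> - {S'}" using S'' False MS S0 by auto
        ultimately have "S' \<subseteq> \<Union>(\<S> - {S'})" by blast
        with priv S' S0 show False by blast
      qed
      ultimately have "card (T - S'') = 1" using E by (intro card_diff_eq_1)
      with S'' show ?thesis by blast
    qed (use S' in blast)
  qed
  ultimately show "self_disjoint E \<S>"
    unfolding self_disjoint_def using S priv MS S0
    by (intro self_disj_auxI[of _ _ M]) (simp_all add: subset_trans[OF MS S0])
qed

end

section \<open>Multigraded strands of the Koszul complex\<close>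

lemma enum_set:
  assumes "finite B"
  shows "distinct (enum_set B)" "set (enum_set B) = B"
proof -
  have "\<exists>xs. distinct xs \<and> set xs = B" using finite_distinct_list[OF assms] by blast
  then have "distinct (enum_set B) \<and> set (enum_set B) = B"
    unfolding enum_set_def by (rule someI_ex)
  then show "distinct (enum_set B)" "set (enum_set B) = B" by blast+
qed

lemma mat_mult_vec_of_lists:
  fixes f :: "'a \<Rightarrow> 'b \<Rightarrow> 'k::field"
  assumes "distinct cs"
  shows "mat (length rs) (length cs) (\<lambda>(r, c). f (rs ! r) (cs ! c)) *\<^sub>v vec (length cs) (\<lambda>i. g (cs ! i))
    = vec (length rs) (\<lambda>r. \<Sum>s\<in>set cs. f (rs ! r) s * g s)" (is "?A *\<^sub>v ?v = ?w")
proof (rule eq_vecI)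
  fix r assume "r < dim_vec ?w"
  then have r: "r < length rs" by simp
  have "(?A *\<^sub>v ?v) $ r = (\<Sum>i\<in>{0..<length cs}. f (rs ! r) (cs ! i) * g (cs ! i))"
    using r by (simp add: scalar_prod_def)
  also have "\<dots> = (\<Sum>s\<in>set cs. f (rs ! r) s * g s)"
    using bij_betw_nth[OF assms, of "{0..<length cs}" "set cs"]
    by (intro sum.reindex_bij_betw) (auto simp: atLeast0LessThan)
  finally show "(?A *\<^sub>v ?v) $ r = ?w $ r" using r by simp
qed simp

lemma vec_of_list_fun:
  assumes "distinct cs" "v \<in> carrier_vec (length cs)"
  obtains g where "v = vec (length cs) (\<lambda>i. g (cs ! i))"
proof
  show "v = vec (length cs) (\<lambda>i. v $ (THE k. k < length cs \<and> cs ! k = cs ! i))"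
  proof (rule eq_vecI)
    fix i assume "i < dim_vec (vec (length cs) (\<lambda>i. v $ (THE k. k < length cs \<and> cs ! k = cs ! i)))"
    then have i: "i < length cs" by simp
    then have "(THE k. k < length cs \<and> cs ! k = cs ! i) = i"
      using assms(1) by (intro the_equality) (auto simp: nth_eq_iff_index_eq)
    with i show "v $ i = vec (length cs) (\<lambda>i. v $ (THE k. k < length cs \<and> cs ! k = cs ! i)) $ i"
      by simp
  qed (use assms in simp)
qed

lemma vec_fun_eq_iff:
  "vec (length xs) (\<lambda>i. f (xs ! i)) = vec (length xs) (\<lambda>i. g (xs ! i)) \<longleftrightarrow> (\<forall>x\<in>set xs. f x = g x)"
  by (auto simp: vec_eq_iff set_conv_nth)

lemma finite_mons: "finite (mons n t)"
proof (rule finite_subset)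
  show "mons n t \<subseteq> {m. \<forall>k. (k \<in> {..<n} \<longrightarrow> m k \<in> {..t}) \<and> (k \<notin> {..<n} \<longrightarrow> m k = 0)}"
    by (auto simp: mons_def intro: member_le_sum)
  show "finite {m. \<forall>k. (k \<in> {..<n} \<longrightarrow> m k \<in> {..t}) \<and> (k \<notin> {..<n} \<longrightarrow> m k = (0::nat))}"
    by (intro finite_set_of_finite_funs) auto
qed

lemma finite_kbasis: "finite (kbasis E n i j)"
  by (rule finite_subset[of _ "Pow {..<n} \<times> mons n (j - i)"])
    (auto simp: kbasis_def finite_mons)

definition koszul_map ::
  "nat set set \<Rightarrow> nat \<Rightarrow> nat \<Rightarrow> nat \<Rightarrow> (nat set \<times> (nat \<Rightarrow> nat) \<Rightarrow> 'k::field) \<Rightarrow> nat set \<times> (nat \<Rightarrow> nat) \<Rightarrow> 'k"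
  where "koszul_map E n i j c t = (\<Sum>s\<in>kbasis E n i j. koszul_coeff t s * c s)"

text \<open>The exponent vector of the monomial paired with \<open>e_F\<close> in multidegree
  \<open>a\<close>. Truncated subtraction loses nothing when \<open>F\<close> lies in
  \<open>supp a\<close>.\<close>

definition reduce :: "(nat \<Rightarrow> nat) \<Rightarrow> nat set \<Rightarrow> nat \<Rightarrow> nat" where
  "reduce a F = (\<lambda>k. a k - (if k \<in> F then 1 else 0))"

definition mdegree :: "nat set \<times> (nat \<Rightarrow> nat) \<Rightarrow> nat \<Rightarrow> nat" where
  "mdegree s = (\<lambda>k. snd s k + (if k \<in> fst s then 1 else 0))"

definition supp :: "(nat \<Rightarrow> nat) \<Rightarrow> nat set" where
  "supp a = {k. 0 < a k}"

text \<open>The basis of the Koszul complex in multidegree \<open>a\<close>.\<close>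
definition strand :: "nat set set \<Rightarrow> (nat \<Rightarrow> nat) \<Rightarrow> nat set set" where
  "strand E a = {F. F \<subseteq> supp a \<and> std_mon E (reduce a F)}"

lemma supp_mons: "a \<in> mons n j \<Longrightarrow> supp a \<subseteq> {..<n}"
  by (auto simp: supp_def mons_def not_less[symmetric])

lemma sum_reduce:
  assumes "F \<subseteq> supp a" "supp a \<subseteq> {..<n}"
  shows "(\<Sum>k<n. reduce a F k) + card F = (\<Sum>k<n. a k)"
proof -
  have "(\<Sum>k<n. a k) = (\<Sum>k<n. reduce a F k + (if k \<in> F then 1 else 0))"
    using assms by (intro sum.cong) (auto simp: reduce_def supp_def)
  also have "\<dots> = (\<Sum>k<n. reduce a F k) + (\<Sum>k\<in>{..<n} \<inter> F. 1)"
    by (simp add: sum.distrib sum.If_cases)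
  also have "{..<n} \<inter> F = F" using assms by auto
  finally show ?thesis by simp
qed

lemma reduce_mdegree [simp]: "reduce (mdegree (F, m)) F = m"
  by (auto simp: reduce_def mdegree_def)

lemma mdegree_reduce: "F \<subseteq> supp a \<Longrightarrow> mdegree (F, reduce a F) = a"
  by (auto simp: reduce_def mdegree_def supp_def fun_eq_iff)

lemma kbasis_reduce_iff:
  assumes a: "a \<in> mons n j" and F: "F \<subseteq> supp a"
  shows "(F, reduce a F) \<in> kbasis E n i j \<longleftrightarrow> F \<in> strand E a \<and> card F = i"
proof -
  have sub: "supp a \<subseteq> {..<n}" by (rule supp_mons[OF a])
  have "(\<Sum>k<n. reduce a F k) + card F = j" using sum_reduce[OF F sub] a by (simp add: mons_def)
  moreover have "\<forall>k\<ge>n. reduce a F k = 0" using a by (simp add: mons_def reduce_def)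
  ultimately show ?thesis using F sub by (auto simp: kbasis_def strand_def mons_def)
qed

lemma kbasis_mdegree:
  assumes "(F, m) \<in> kbasis E n i j"
  shows "mdegree (F, m) \<in> mons n j" "F \<subseteq> supp (mdegree (F, m))" "F \<in> strand E (mdegree (F, m))" "card F = i"
proof -
  let ?a = "mdegree (F, m)"
  have F: "F \<subseteq> {..<n}" "card F = i" "i \<le> j" and m: "m \<in> mons n (j - i)" "std_mon E m"
    using assms by (auto simp: kbasis_def)
  show sF: "F \<subseteq> supp ?a" by (auto simp: supp_def mdegree_def)
  have z: "?a k = 0" if "n \<le> k" for k using that m F by (auto simp: mdegree_def mons_def)
  have "supp ?a \<subseteq> {..<n}"
  proof
    fix k assume "k \<in> supp ?a"
    then have "?a k \<noteq> 0" by (simp add: supp_def)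
    with z[of k] show "k \<in> {..<n}" by (cases "n \<le> k") auto
  qed
  then have "(\<Sum>k<n. ?a k) = (\<Sum>k<n. m k) + card F" using sum_reduce[OF sF] by simp
  then show "?a \<in> mons n j" using z m F by (simp add: mons_def)
  show "F \<in> strand E ?a" using m sF by (simp add: strand_def)
  show "card F = i" by (rule F)
qed

lemma strand_insert:
  assumes "G \<in> strand E a" "k \<in> supp a"
  shows "insert k G \<in> strand E a"
proof -
  have "reduce a (insert k G) l \<le> reduce a G l" for l by (simp add: reduce_def)
  then have "0 < reduce a G l" if "0 < reduce a (insert k G) l" for l
    using that by (meson less_le_trans)
  then have "std_mon E (reduce a (insert k G))" if "std_mon E (reduce a G)"
    using that unfolding std_mon_def by meson
  with assms show ?thesis by (simp add: strand_def)
qed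

text \<open>The differential preserves multidegrees: trading \<open>e_k\<close> for the factor
  \<open>x_k\<close> leaves the total exponent unchanged, so the monomial of the source is
  forced.\<close>

lemma koszul_coeff_nonzero:
  assumes nz: "koszul_coeff (G, reduce a G) (F, m) \<noteq> (0::'k::field)" and G: "G \<subseteq> supp a"
  obtains k where "k \<in> supp a - G" "F = insert k G" "m = reduce a F"
proof -
  have GF: "G \<subseteq> F" "card (F - G) = 1" and upd: "reduce a G = m(the_elem (F - G) := Suc (m (the_elem (F - G))))"
    using nz by (auto simp: koszul_coeff_def split: if_splits)
  then obtain k where k: "F - G = {k}" by (auto simp: card_1_singleton_iff)
  then have F: "F = insert k G" and kG: "k \<notin> G" using GF by auto
  have upd: "reduce a G = m(k := Suc (m k))" using upd k by simp
  then have "reduce a G k = Suc (m k)" by simp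
  then have "a k = Suc (m k)" using kG by (simp add: reduce_def)
  then have "k \<in> supp a" by (simp add: supp_def)
  moreover have "m l = reduce a F l" for l
    using fun_cong[OF upd, of l] \<open>a k = Suc (m k)\<close> by (cases "l = k") (auto simp: reduce_def F)
  ultimately show ?thesis using that kG F by blast
qed

lemma koszul_coeff_insert:
  assumes "k \<in> supp a - G"
  shows "koszul_coeff (G, reduce a G) (insert k G, reduce a (insert k G)) = (koszul_sign k G :: 'k::field)"
proof -
  have d: "insert k G - G = {k}" using assms by auto
  have l: "{l \<in> insert k G. l < k} = {l \<in> G. l < k}" by auto
  have "reduce a G = (reduce a (insert k G))(k := Suc (reduce a (insert k G) k))"
    using assms by (auto simp: reduce_def supp_def fun_eq_iff)
  then show ?thesis unfolding koszul_coeff_def prod.case d the_elem_eq l koszul_sign_def by auto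
qed

text \<open>Nonzero coefficients come only from the sets \<open>insert k G\<close> in the same
  multidegree, and \<open>strand_insert\<close> keeps all of these in the basis.\<close>

lemma koszul_map_eq_diff:
  assumes a: "a \<in> mons n j" and G: "G \<in> strand E a" and i: "Suc (card G) = i"
  shows "koszul_map E n i j c (G, reduce a G) = koszul_diff (supp a) (\<lambda>F. c (F, reduce a F)) G"
proof -
  let ?h = "\<lambda>k. (insert k G, reduce a (insert k G))"
  have sG: "G \<subseteq> supp a" using G by (simp add: strand_def)
  have fG: "finite G" using finite_subset[OF sG finite_subset[OF supp_mons[OF a]]] by simp
  have "?h ` (supp a - G) \<subseteq> kbasis E n i j"
  proof
    fix s assume "s \<in> ?h ` (supp a - G)"
    then obtain k where k: "k \<in> supp a" "k \<notin> G" "s = ?h k" by auto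
    then have "insert k G \<subseteq> supp a" "insert k G \<in> strand E a" "card (insert k G) = i"
      using sG strand_insert[OF G] fG i by auto
    with k show "s \<in> kbasis E n i j" using kbasis_reduce_iff[OF a] by simp
  qed
  moreover have "koszul_coeff (G, reduce a G) s * c s = 0" if "s \<in> kbasis E n i j - ?h ` (supp a - G)" for s
  proof (rule ccontr)
    assume nz: "koszul_coeff (G, reduce a G) s * c s \<noteq> 0"
    obtain F m where s: "s = (F, m)" by (cases s)
    with nz have nz: "koszul_coeff (G, reduce a G) (F, m) \<noteq> (0::'a)" by auto
    obtain k where "k \<in> supp a - G" "F = insert k G" "m = reduce a F"
      using koszul_coeff_nonzero[OF nz sG] .
    with s have "s \<in> ?h ` (supp a - G)" by blast
    with that show False by simp
  qed
  ultimately have "koszul_map E n i j c (G, reduce a G)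
      = (\<Sum>s\<in>?h ` (supp a - G). koszul_coeff (G, reduce a G) s * c s)"
    unfolding koszul_map_def by (intro sum.mono_neutral_right finite_kbasis) auto
  also have "\<dots> = (\<Sum>k\<in>supp a - G. koszul_coeff (G, reduce a G) (?h k) * c (?h k))"
    by (subst sum.reindex) (auto intro!: inj_onI)
  also have "\<dots> = (\<Sum>k\<in>supp a - G. koszul_sign k G * c (?h k))"
    by (intro sum.cong refl) (simp add: koszul_coeff_insert)
  finally show ?thesis by (simp add: koszul_diff_def)
qed

text \<open>The guard covers \<open>i = 0\<close>, where every chain is a cycle and the truncated
  \<open>i - 1\<close> would name degree 0 again.\<close>

definition koszul_exact_at :: "'k::field itself \<Rightarrow> nat set set \<Rightarrow> nat \<Rightarrow> nat \<Rightarrow> nat \<Rightarrow> bool" where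
  "koszul_exact_at K E n i j \<longleftrightarrow> (\<forall>c :: nat set \<times> (nat \<Rightarrow> nat) \<Rightarrow> 'k.
     (i \<noteq> 0 \<longrightarrow> (\<forall>t\<in>kbasis E n (i - 1) j. koszul_map E n i j c t = 0)) \<longrightarrow>
     (\<exists>b. \<forall>s\<in>kbasis E n i j. koszul_map E n (Suc i) j b s = c s))"

lemma koszul_map_map:
  assumes "i \<noteq> 0" "t \<in> kbasis E n (i - 1) j"
  shows "koszul_map E n i j (koszul_map E n (Suc i) j b) t = (0::'k::field)"
proof -
  obtain G m where t: "t = (G, m)" by (cases t)
  define a where "a = mdegree (G, m)"
  have a: "a \<in> mons n j" "G \<subseteq> supp a" "G \<in> strand E a" "card G = i - 1"
    using kbasis_mdegree[OF assms(2)[unfolded t]] unfolding a_def .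
  have t: "t = (G, reduce a G)" by (simp add: t a_def)
  have fs: "finite (supp a)" using finite_subset[OF supp_mons[OF a(1)]] by simp
  have fG: "finite G" using finite_subset[OF a(2) fs] .
  have "koszul_map E n i j (koszul_map E n (Suc i) j b) t
      = koszul_diff (supp a) (\<lambda>F. koszul_map E n (Suc i) j b (F, reduce a F)) G"
    unfolding t using a assms(1) by (intro koszul_map_eq_diff) auto
  also have "\<dots> = koszul_diff (supp a) (koszul_diff (supp a) (\<lambda>F. b (F, reduce a F))) G"
  proof (rule koszul_diff_cong)
    fix k assume "k \<in> supp a - G"
    then show "koszul_map E n (Suc i) j b (insert k G, reduce a (insert k G))
        = koszul_diff (supp a) (\<lambda>F. b (F, reduce a F)) (insert k G)"
      using a fG assms(1) strand_insert[OF a(3)] by (intro koszul_map_eq_diff) auto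
  qed
  also have "\<dots> = 0" using koszul_diff_diff[OF fs a(2)] .
  finally show ?thesis .
qed

lemma koszul_exact_at_iff:
  fixes K :: "'k::field itself"
  shows "koszul_exact_at K E n i j \<longleftrightarrow> (\<forall>a\<in>mons n j. koszul_exact K (supp a) (strand E a) (int i))"
proof (intro iffI ballI)
  fix a assume ex: "koszul_exact_at K E n i j" and a: "a \<in> mons n j"
  show "koszul_exact K (supp a) (strand E a) (int i)" unfolding koszul_exact_def
  proof (intro allI impI)
    fix c :: "nat set \<Rightarrow> 'k"
    assume cyc: "\<forall>G\<in>strand E a. int (card G) = int i - 1 \<longrightarrow> koszul_diff (supp a) c G = 0"
    define c' where "c' s = (if mdegree s = a then c (fst s) else 0)" for s
    have "koszul_map E n i j c' t = 0" if "i \<noteq> 0" "t \<in> kbasis E n (i - 1) j" for t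
    proof -
      obtain G m where t: "t = (G, m)" by (cases t)
      define a' where "a' = mdegree (G, m)"
      have a': "a' \<in> mons n j" "G \<subseteq> supp a'" "G \<in> strand E a'" "card G = i - 1"
        using kbasis_mdegree[OF that(2)[unfolded t]] unfolding a'_def .
      have t: "t = (G, reduce a' G)" by (simp add: t a'_def)
      have "koszul_map E n i j c' t = koszul_diff (supp a') (\<lambda>F. c' (F, reduce a' F)) G"
        unfolding t using a' that(1) by (intro koszul_map_eq_diff) auto
      also have "\<dots> = koszul_diff (supp a') (\<lambda>F. if a' = a then c F else 0) G"
        using a'(2) by (intro koszul_diff_cong) (simp add: c'_def mdegree_reduce)
      also have "\<dots> = 0"
      proof (cases "a' = a")
        case True
        with cyc a' that(1) show ?thesis by (simp add: of_nat_diff)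
      qed simp
      finally show ?thesis .
    qed
    then obtain b where b: "\<forall>s\<in>kbasis E n i j. koszul_map E n (Suc i) j b s = c' s"
      using ex unfolding koszul_exact_at_def by blast
    have "koszul_diff (supp a) (\<lambda>F. b (F, reduce a F)) F = c F"
      if F: "F \<in> strand E a" "int (card F) = int i" for F
    proof -
      have sF: "F \<subseteq> supp a" using F by (simp add: strand_def)
      have "(F, reduce a F) \<in> kbasis E n i j" using kbasis_reduce_iff[OF a sF] F by simp
      with b have "koszul_map E n (Suc i) j b (F, reduce a F) = c F"
        by (simp add: c'_def mdegree_reduce[OF sF])
      with koszul_map_eq_diff[OF a F(1), of "Suc i" b] F(2) show ?thesis by simp
    qed
    then show "\<exists>b. \<forall>F\<in>strand E a. int (card F) = int i \<longrightarrow> koszul_diff (supp a) b F = c F" by blast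
  qed
next
  assume ex: "\<forall>a\<in>mons n j. koszul_exact K (supp a) (strand E a) (int i)"
  show "koszul_exact_at K E n i j" unfolding koszul_exact_at_def
  proof (intro allI impI)
    fix c :: "nat set \<times> (nat \<Rightarrow> nat) \<Rightarrow> 'k"
    assume cyc: "i \<noteq> 0 \<longrightarrow> (\<forall>t\<in>kbasis E n (i - 1) j. koszul_map E n i j c t = 0)"
    have "\<exists>b. \<forall>F\<in>strand E a. int (card F) = int i \<longrightarrow> koszul_diff (supp a) b F = c (F, reduce a F)"
      if a: "a \<in> mons n j" for a
    proof -
      have "koszul_diff (supp a) (\<lambda>F. c (F, reduce a F)) G = 0"
        if G: "G \<in> strand E a" "int (card G) = int i - 1" for G
      proof -
        have sG: "G \<subseteq> supp a" using G by (simp add: strand_def)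
        have i: "Suc (card G) = i" using G(2) by linarith
        then have "(G, reduce a G) \<in> kbasis E n (i - 1) j" using kbasis_reduce_iff[OF a sG] G by auto
        with cyc i koszul_map_eq_diff[OF a G(1) i, of c] show ?thesis by auto
      qed
      with ex a show ?thesis unfolding koszul_exact_def by blast
    qed
    \<comment> \<open>A primitive is chosen in each multidegree; every basis element has exactly one
      multidegree, so \<open>mdegree\<close> glues the choices.\<close>
    then obtain \<beta> where \<beta>: "\<And>a F. a \<in> mons n j \<Longrightarrow> F \<in> strand E a \<Longrightarrow> card F = i \<Longrightarrow>
        koszul_diff (supp a) (\<beta> a) F = c (F, reduce a F)"
      by (metis (no_types, lifting))
    have "koszul_map E n (Suc i) j (\<lambda>s. \<beta> (mdegree s) (fst s)) s = c s" if "s \<in> kbasis E n i j" for s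
    proof -
      obtain F m where s: "s = (F, m)" by (cases s)
      define a where "a = mdegree (F, m)"
      have a: "a \<in> mons n j" "F \<subseteq> supp a" "F \<in> strand E a" "card F = i"
        using kbasis_mdegree[OF that[unfolded s]] unfolding a_def .
      have s: "s = (F, reduce a F)" by (simp add: s a_def)
      have "koszul_map E n (Suc i) j (\<lambda>s. \<beta> (mdegree s) (fst s)) s
          = koszul_diff (supp a) (\<lambda>F. \<beta> (mdegree (F, reduce a F)) F) F"
        unfolding s using koszul_map_eq_diff[OF a(1,3), of "Suc i" "\<lambda>s. \<beta> (mdegree s) (fst s)"] a(4)
        by simp
      also have "\<dots> = koszul_diff (supp a) (\<beta> a) F"
        using a(2) by (intro koszul_diff_cong) (simp add: mdegree_reduce)
      also have "\<dots> = c s" using \<beta> a s by simp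
      finally show ?thesis .
    qed
    then show "\<exists>b. \<forall>s\<in>kbasis E n i j. koszul_map E n (Suc i) j b s = c s" by blast
  qed
qed

lemma betti_nonzero_iff:
  fixes K :: "'k::field itself"
  shows "betti K n E i j \<noteq> 0 \<longleftrightarrow> \<not> koszul_exact_at K E n i j"
proof -
  define xs where "xs l = enum_set (kbasis E n l j)" for l
  have xs: "distinct (xs l)" "set (xs l) = kbasis E n l j" "length (xs l) = card (kbasis E n l j)" for l
    using enum_set[OF finite_kbasis] distinct_card unfolding xs_def by metis+
  have M: "koszul_mat E n l j = mat (length (xs (l - 1))) (length (xs l))
      (\<lambda>(r, c). koszul_coeff (xs (l - 1) ! r) (xs l ! c) :: 'k)" for l
    by (simp add: koszul_mat_def xs_def Let_def)
  have mult: "koszul_mat E n l j *\<^sub>v vec (length (xs l)) (\<lambda>i. g (xs l ! i))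
      = vec (length (xs (l - 1))) (\<lambda>r. koszul_map E n l j g (xs (l - 1) ! r))" for l and g :: "_ \<Rightarrow> 'k"
    unfolding M koszul_map_def xs(2)[symmetric] by (rule mat_mult_vec_of_lists[OF xs(1)])
  define p where "p = (if i = 0 then 0 else length (xs (i - 1)))"
  \<comment> \<open>For \<open>i = 0\<close> the rows of \<open>koszul_mat\<close> would be indexed
    by degree 0, because \<open>0 - 1 = 0\<close>. A matrix without rows stands for the zero map
    instead and has rank 0, as in \<open>koszul_rank\<close>.\<close>
  define A where "A = (if i = 0 then 0\<^sub>m 0 (length (xs 0)) else koszul_mat E n i j :: 'k mat)"
  define B where "B = (koszul_mat E n (Suc i) j :: 'k mat)"
  have A: "A \<in> carrier_mat p (length (xs i))" and B: "B \<in> carrier_mat (length (xs i)) (length (xs (Suc i)))"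
    by (auto simp: A_def B_def M p_def)
  have rA: "koszul_rank K E n i j = vec_space.rank p A"
    by (simp add: koszul_rank_def A_def p_def vec_space.rank_0I M)
  have rB: "koszul_rank K E n (Suc i) j = vec_space.rank (length (xs i)) B"
    by (simp add: koszul_rank_def B_def M)
  have A0: "A *\<^sub>v vec (length (xs i)) (\<lambda>k. g (xs i ! k)) = 0\<^sub>v p \<longleftrightarrow>
      (i \<noteq> 0 \<longrightarrow> (\<forall>t\<in>kbasis E n (i - 1) j. koszul_map E n i j g t = 0))" for g
  proof (cases "i = 0")
    case False
    have "A *\<^sub>v vec (length (xs i)) (\<lambda>k. g (xs i ! k)) = 0\<^sub>v p \<longleftrightarrow>
      vec (length (xs (i - 1))) (\<lambda>r. koszul_map E n i j g (xs (i - 1) ! r)) = vec (length (xs (i - 1))) (\<lambda>r. 0)"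
      using False by (simp add: A_def p_def mult zero_vec_def)
    also have "\<dots> \<longleftrightarrow> (\<forall>t\<in>kbasis E n (i - 1) j. koszul_map E n i j g t = 0)"
      using vec_fun_eq_iff[of "xs (i - 1)" "koszul_map E n i j g" "\<lambda>_. 0"] xs(2) by simp
    finally show ?thesis using False by simp
  qed (auto simp: A_def p_def)
  have BV: "B *\<^sub>v vec (length (xs (Suc i))) (\<lambda>k. b (xs (Suc i) ! k)) = vec (length (xs i)) (\<lambda>k. c (xs i ! k))
      \<longleftrightarrow> (\<forall>s\<in>kbasis E n i j. koszul_map E n (Suc i) j b s = c s)" for b c
    using vec_fun_eq_iff[of "xs i" "koszul_map E n (Suc i) j b" c] xs(2) by (simp add: B_def mult)
  have AB: "A *\<^sub>v (B *\<^sub>v w) = 0\<^sub>v p" if w: "w \<in> carrier_vec (length (xs (Suc i)))" for w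
  proof -
    obtain b where "w = vec (length (xs (Suc i))) (\<lambda>k. b (xs (Suc i) ! k))"
      using vec_of_list_fun[OF xs(1) w] .
    then have "B *\<^sub>v w = vec (length (xs i)) (\<lambda>k. koszul_map E n (Suc i) j b (xs i ! k))"
      by (simp add: B_def mult)
    moreover have "i \<noteq> 0 \<longrightarrow>
        (\<forall>t\<in>kbasis E n (i - 1) j. koszul_map E n i j (koszul_map E n (Suc i) j b) t = 0)"
      using koszul_map_map by blast
    ultimately show ?thesis using A0[of "koszul_map E n (Suc i) j b"] by simp
  qed
  \<comment> \<open>Truncated subtraction: \<open>betti\<close> vanishes as soon as the two ranks
    add up to at least the number of basis elements.\<close>
  have "betti K n E i j = 0 \<longleftrightarrow> length (xs i) \<le> vec_space.rank p A + vec_space.rank (length (xs i)) B"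
    unfolding betti_def rA rB xs(3) by linarith
  also have "\<dots> \<longleftrightarrow> (\<forall>v \<in> carrier_vec (length (xs i)). A *\<^sub>v v = 0\<^sub>v p \<longrightarrow>
      (\<exists>w \<in> carrier_vec (length (xs (Suc i))). B *\<^sub>v w = v))"
    by (rule rank_add_rank_ge_iff[OF A B AB])
  also have "\<dots> \<longleftrightarrow> koszul_exact_at K E n i j"
    unfolding koszul_exact_at_def
  proof (intro iffI allI impI ballI)
    fix c :: "nat set \<times> (nat \<Rightarrow> nat) \<Rightarrow> 'k"
    assume *: "\<forall>v \<in> carrier_vec (length (xs i)). A *\<^sub>v v = 0\<^sub>v p \<longrightarrow>
        (\<exists>w \<in> carrier_vec (length (xs (Suc i))). B *\<^sub>v w = v)"
      and "i \<noteq> 0 \<longrightarrow> (\<forall>t\<in>kbasis E n (i - 1) j. koszul_map E n i j c t = 0)"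
    then obtain w where w: "w \<in> carrier_vec (length (xs (Suc i)))"
      "B *\<^sub>v w = vec (length (xs i)) (\<lambda>k. c (xs i ! k))"
      using A0[of c] by (metis vec_carrier)
    obtain b where "w = vec (length (xs (Suc i))) (\<lambda>k. b (xs (Suc i) ! k))"
      using vec_of_list_fun[OF xs(1) w(1)] .
    with w(2) BV[of b c] show "\<exists>b. \<forall>s\<in>kbasis E n i j. koszul_map E n (Suc i) j b s = c s" by auto
  next
    fix v :: "'k vec"
    assume *: "\<forall>c :: nat set \<times> (nat \<Rightarrow> nat) \<Rightarrow> 'k.
       (i \<noteq> 0 \<longrightarrow> (\<forall>t\<in>kbasis E n (i - 1) j. koszul_map E n i j c t = 0)) \<longrightarrow>
       (\<exists>b. \<forall>s\<in>kbasis E n i j. koszul_map E n (Suc i) j b s = c s)"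
      and v: "v \<in> carrier_vec (length (xs i))" "A *\<^sub>v v = 0\<^sub>v p"
    obtain c where c: "v = vec (length (xs i)) (\<lambda>k. c (xs i ! k))"
      using vec_of_list_fun[OF xs(1) v(1)] .
    have "i \<noteq> 0 \<longrightarrow> (\<forall>t\<in>kbasis E n (i - 1) j. koszul_map E n i j c t = 0)"
      using A0[of c] v(2) c by simp
    with * obtain b where "\<forall>s\<in>kbasis E n i j. koszul_map E n (Suc i) j b s = c s" by blast
    then have "B *\<^sub>v vec (length (xs (Suc i))) (\<lambda>k. b (xs (Suc i) ! k)) = v" using BV[of b c] c by simp
    then show "\<exists>w \<in> carrier_vec (length (xs (Suc i))). B *\<^sub>v w = v" by (metis vec_carrier)
  qed
  finally show ?thesis by simp
qed

section \<open>Hochster's formula\<close>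

lemma strand_not_squarefree:
  assumes a: "a \<in> mons n j" and k: "1 < a k"
  shows "koszul_exact K (supp a) (strand E a) i"
proof (rule koszul_exact_cone)
  show "finite (supp a)" using finite_subset[OF supp_mons[OF a]] by simp
  show "k \<in> supp a" using k by (simp add: supp_def)
  show "strand E a \<subseteq> Pow (supp a)" by (auto simp: strand_def)
  fix H assume H: "H \<in> strand E a" "k \<in> H"
  \<comment> \<open>With exponent at least 2, variable \<open>k\<close> divides the monomial whether
    or not \<open>k\<close> lies in \<open>H\<close>, so \<open>k\<close> is a cone point.\<close>
  have "0 < reduce a (H - {k}) l \<longleftrightarrow> 0 < reduce a H l" for l
    using k by (auto simp: reduce_def)
  then have "std_mon E (reduce a (H - {k}))" if "std_mon E (reduce a H)"
    using that by (simp add: std_mon_def)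
  with H show "H - {k} \<in> strand E a" by (auto simp: strand_def)
qed

lemma strand_squarefree:
  assumes "\<And>k. a k \<le> 1"
  shows "strand E a = indep_compl E (supp a) {}"
proof -
  have "0 < reduce a F k \<longleftrightarrow> k \<in> supp a - F" for F k
    using assms[of k] by (auto simp: reduce_def supp_def)
  then show ?thesis by (auto simp: strand_def indep_compl_def std_mon_def subset_iff)
qed

text \<open>By \<open>strand_not_squarefree\<close> only squarefree multidegrees contribute, and
  these are the sets \<open>W\<close> with \<open>j\<close> elements. Basis sets of size
  \<open>i\<close> are complements of faces with \<open>j - i\<close> vertices.\<close>

lemma hochster:
  fixes K :: "'k::field itself"
  shows "betti K n E i j \<noteq> 0 \<longleftrightarrow>
    (\<exists>W\<subseteq>{..<n}. card W = j \<and> \<not> acyclic_at K E W {} (int j - int i))"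
proof
  assume "betti K n E i j \<noteq> 0"
  then obtain a where a: "a \<in> mons n j" "\<not> koszul_exact K (supp a) (strand E a) (int i)"
    using betti_nonzero_iff koszul_exact_at_iff by metis
  have le: "a k \<le> 1" for k
    using strand_not_squarefree[OF a(1), of k K E "int i"] a(2) by (meson not_le)
  have sub: "supp a \<subseteq> {..<n}" by (rule supp_mons[OF a(1)])
  have "a k = (if k \<in> supp a then 1 else 0)" for k using le[of k] by (auto simp: supp_def)
  then have "(\<Sum>k<n. a k) = card (supp a)"
    using sub by (simp add: sum.If_cases Int_absorb1)
  then have "card (supp a) = j" using a(1) by (simp add: mons_def)
  with a(2) sub show "\<exists>W\<subseteq>{..<n}. card W = j \<and> \<not> acyclic_at K E W {} (int j - int i)"
    by (intro exI[of _ "supp a"]) (simp add: acyclic_at_def strand_squarefree[OF le])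
next
  assume "\<exists>W\<subseteq>{..<n}. card W = j \<and> \<not> acyclic_at K E W {} (int j - int i)"
  then obtain W where W: "W \<subseteq> {..<n}" "card W = j" "\<not> acyclic_at K E W {} (int j - int i)" by blast
  define a :: "nat \<Rightarrow> nat" where "a k = (if k \<in> W then 1 else 0)" for k
  have sa: "supp a = W" by (auto simp: supp_def a_def)
  have "(\<Sum>k<n. a k) = card W"
    using W(1) by (simp add: a_def sum.If_cases Int_absorb1)
  then have "a \<in> mons n j" using W(1,2) by (auto simp: mons_def a_def)
  moreover have "\<not> koszul_exact K (supp a) (strand E a) (int i)"
    using W(2,3) strand_squarefree[of a E] by (simp add: acyclic_at_def sa a_def)
  ultimately show "betti K n E i j \<noteq> 0" using betti_nonzero_iff koszul_exact_at_iff by metis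
qed

section \<open>Betti numbers, projective dimension and regularity\<close>

theorem theorem3p5:
  fixes K :: "'k::field itself" and n d :: nat and E :: "nat set set"
  assumes "2 \<le> d"
    and "simple_hypergraph n E"
    and "uniform d E"
    and "triangulated d n E"
    and "\<forall>S\<in>E. \<forall>S'\<in>E. S \<noteq> S' \<and> S \<inter> S' \<noteq> {} \<longrightarrow> card (S \<inter> S') = d - 1"
  shows "(\<forall>i j. betti K n E i j \<noteq> 0 \<longleftrightarrow> (\<exists>\<S>. self_disjoint E \<S> \<and> has_type \<S> i j))
    \<and> proj_dim K n E = d1 E \<and> d1 E = d2 E
    \<and> regularity K n E = d1' E \<and> d1' E = d2' E"
proof -
  interpret sunflower_hypergraph d E
    using assms(1,3,5) by unfold_locales (auto simp: uniform_def)
  have EV: "E \<subseteq> Pow {..<n}" using assms(2) by (auto simp: simple_hypergraph_def)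
  then have fE: "finite E" by (rule finite_subset) simp
  have tri: "\<exists>x\<in>W. simplicial d (induced_edges E W) x" if "W \<subseteq> {..<n}" "W \<noteq> {}" for W
    using assms(4) that by (simp add: triangulated_def)
  have betti: "betti K n E i j \<noteq> 0 \<longleftrightarrow> (\<exists>\<S>. self_disjoint E \<S> \<and> has_type \<S> i j)" for i j
  proof
    assume "betti K n E i j \<noteq> 0"
    then obtain W where W: "W \<subseteq> {..<n}" "card W = j" "\<not> acyclic_at K E W {} (int j - int i)"
      unfolding hochster by blast
    have "finite W" using finite_subset[OF W(1)] by simp
    then obtain \<S> where "self_disjoint E \<S>" "\<Union>\<S> = W" "int (card \<S>) + (int j - int i) = int (card W)"
      using acyclic_at_iff[OF tri _ W(1), of K "int j - int i"] W(3) by auto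
    with W(2) show "\<exists>\<S>. self_disjoint E \<S> \<and> has_type \<S> i j"
      by (intro exI[of _ \<S>]) (simp add: has_type_def)
  next
    assume "\<exists>\<S>. self_disjoint E \<S> \<and> has_type \<S> i j"
    then obtain \<S> where S: "self_disjoint E \<S>" "card \<S> = i" "card (\<Union>\<S>) = j"
      by (auto simp: has_type_def)
    have "\<S> \<subseteq> E" using S(1) by (simp add: self_disjoint_def self_disj_aux_def)
    then have sub: "\<Union>\<S> \<subseteq> {..<n}" using EV by blast
    then have fin: "finite (\<Union>\<S>)" by (rule finite_subset) simp
    have "\<not> acyclic_at K E (\<Union>\<S>) {} (int j - int i)"
      using acyclic_at_iff[OF tri fin sub, of K "int j - int i"] S by auto
    with sub S(3) show "betti K n E i j \<noteq> 0" unfolding hochster by blast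
  qed
  have semi: "self_semi_disjoint E = self_disjoint E"
    using self_semi_disjoint_iff[OF fE] by (intro ext)
  \<comment> \<open>After rewriting with the fact \<open>betti\<close>, the homological and the
    combinatorial maxima range over the same sets.\<close>
  have "proj_dim K n E = d1 E" unfolding proj_dim_def d1_def betti by (rule arg_cong[of _ _ Max]) auto
  moreover have "regularity K n E = d1' E" unfolding regularity_def d1'_def betti ..
  ultimately show ?thesis using betti by (auto simp: d1_def d2_def d1'_def d2'_def semi)
qed

end
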